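(* Let $X$ be a $\Lambda$-scheme smooth over $\operatorname{Spec}\mathbb Z$ with an affine $\Lambda$-cover, let $E=\sum_{j\in J}E^j$ be a $\mathbb Z$-flat simple normal crossings divisor on $X$ locally toric on the cover, and let $\mathcal I\subset\mathcal O_X$ be a coherent ideal. If $\mathcal I$ is locally generated by monomials for $E$, then $x\mapsto\operatorname{ord}_x\mathcal I$ is an upper-semicontinuous function on $X$, and so for any $m$, $\operatorname{supp}(\mathcal I,m)=\{x\in X:\operatorname{ord}_x\mathcal I\ge m\}$ is a closed subset of $X$.
   Context: **$\Lambda$-schemes.** A $\Lambda$-structure on a $\mathbb Z$-torsion-free ring $A$ is a family of commuting ring endomorphisms $\psi_p$ ($p$ prime) with $\psi_p(a)-a^p\in pA$. A ring map is $\Lambda$-equivariant if it commutes with all $\psi_p$. A $\Lambda$-scheme is a scheme with an action of Borger's monad $W^*$; for $\mathbb Z$-flat $\operatorname{Spec}A$ this is the same as a $\Lambda$-ring structure on $A$. **Affine $\Lambda$-covers.** An affine $\Lambda$-cover of a $\mathbb Z$-flat $\Lambda$-scheme $X$ is an affine open cover $X=\bigcup_i\operatorname{Spec}A_i$ by affine $\Lambda$-schemes such that each $\operatorname{Spec}A_i\cap\operatorname{Spec}A_j$ is covered by affine $\Lambda$-schemes that are distinguished opens of both, with $\Lambda$-equivariant localization maps, and the $\Lambda$-structure of $X$ is the one glued from these. **Divisors.** $X$ is Noetherian. A simple normal crossings divisor $E=\sum_{j\in J}E^j$ has distinct regular components such that at each point $x$ there are regular parameters $x_1,\dots,x_n$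 of $\mathcal O_{X,x}$ such that each $E^j\ni x$ is defined near $x$ by some $x_{c(j)}$, with $c(j)\neq c(j')$ for $j\ne j'$. It is $\mathbb Z$-flat if its components are flat over $\mathbb Z$. It is locally toric for the cover if on each $\operatorname{Spec}A$ in the cover the $E^j$ meeting $\operatorname{Spec}A$ are defined by elements $x_j\in A$ forming a permutable regular sequence (regular in every order) with $\psi_p(x_j)=x_j^p$ for all primes $p$. **Locally generated by monomials.** $\mathcal I=\sum_{j=1}^r\mathcal I_j$ with $\mathcal I_j=\mathcal O_X(-\sum_{i_j\in J_j}a_{i_j}E^{i_j})$, where $J_j\subset J$ is finite and the $a_{i_j}$ are natural numbers. **Order.** $\operatorname{ord}_x\mathcal I=\max\{n:\mathcal I_x\subset\mathfrak m_x^n\}$, with $\mathfrak m_x\subset\mathcal O_{X,x}$ the maximal ideal. *)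

theory Defs
  imports
    "HOL-Analysis.Analysis"
    "HOL-Algebra.QuotRing"
    "HOL-Algebra.Ideal_Product"
    "HOL-Algebra.Ring_Divisibility"
    "HOL-Combinatorics.Permutations"
    "HOL-Computational_Algebra.Primes"
    "HOL-Library.Extended_Nat"
    "HOL-Library.Poly_Mapping"
begin

text \<open>
  All rings are those of HOL-Algebra. The name \<^const>\<open>Factorial_Ring.prime\<close> is written
  out because HOL-Algebra has a constant \<open>prime\<close> of its own.
\<close>

section \<open>Commutative algebra\<close>

definition local_ring :: "('a, 'b) ring_scheme \<Rightarrow> bool" where
  "local_ring R \<longleftrightarrow> cring R \<and> (\<exists>!M. maximalideal M R)"

definition max_ideal :: "('a, 'b) ring_scheme \<Rightarrow> 'a set" where
  "max_ideal R = (THE M. maximalideal M R)"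

text \<open>Powers, finite products and finite sums of ideals are taken in the semiring of ideals
  \<^const>\<open>ideals_set\<close>, whose unit is the unit ideal.\<close>

definition krull_dim :: "('a, 'b) ring_scheme \<Rightarrow> enat" where
  "krull_dim R = Sup {enat n | n. \<exists>P. (\<forall>i\<le>n. primeideal (P i) R) \<and> (\<forall>i<n. P i \<subset> P (Suc i))}"

definition regular_parameters :: "('a, 'b) ring_scheme \<Rightarrow> 'a list \<Rightarrow> bool" where
  "regular_parameters R xs \<longleftrightarrow>
     local_ring R \<and> noetherian_ring R \<and> set xs \<subseteq> carrier R \<and>
     max_ideal R = Idl\<^bsub>R\<^esub> (set xs) \<and> krull_dim R = enat (length xs)"

definition regular_local_ring :: "('a, 'b) ring_scheme \<Rightarrow> bool" where
  "regular_local_ring R \<longleftrightarrow> (\<exists>xs. regular_parameters R xs)"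

text \<open>Over the principal ideal domain of integers, flat means torsion-free.\<close>

definition Z_flat_ring :: "('a, 'b) ring_scheme \<Rightarrow> bool" where
  "Z_flat_ring R \<longleftrightarrow> (\<forall>n::nat. \<forall>a\<in>carrier R. n > 0 \<and> [n] \<cdot>\<^bsub>R\<^esub> a = \<zero>\<^bsub>R\<^esub> \<longrightarrow> a = \<zero>\<^bsub>R\<^esub>)"

text \<open>The quotient by the whole sequence is allowed to be zero.\<close>

definition regular_sequence :: "('a, 'b) ring_scheme \<Rightarrow> 'a list \<Rightarrow> bool" where
  "regular_sequence R xs \<longleftrightarrow> set xs \<subseteq> carrier R \<and>
     (\<forall>k<length xs. \<forall>a\<in>carrier R.
        xs ! k \<otimes>\<^bsub>R\<^esub> a \<in> Idl\<^bsub>R\<^esub> (set (take k xs)) \<longrightarrow> a \<in> Idl\<^bsub>R\<^esub> (set (take k xs)))"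

definition permutable_regular :: "('a, 'b) ring_scheme \<Rightarrow> 'j set \<Rightarrow> ('j \<Rightarrow> 'a) \<Rightarrow> bool" where
  "permutable_regular R S e \<longleftrightarrow> finite S \<and>
     (\<forall>js. distinct js \<and> set js = S \<longrightarrow> regular_sequence R (map e js))"

subsection \<open>Localization at the complement of a prime\<close>

text \<open>The fraction \<open>a/b\<close> is the set of all pairs \<open>(c, d)\<close> with \<open>c/d = a/b\<close>. The operations take
  the union over all representatives, and these all give the same class.\<close>

definition fraction :: "('a, 'b) ring_scheme \<Rightarrow> 'a set \<Rightarrow> 'a \<Rightarrow> 'a \<Rightarrow> ('a \<times> 'a) set" where
  "fraction R P a b = {(c, d). c \<in> carrier R \<and> d \<in> carrier R - P \<and>
     (\<exists>t\<in>carrier R - P. t \<otimes>\<^bsub>R\<^esub> (a \<otimes>\<^bsub>R\<^esub> d) = t \<otimes>\<^bsub>R\<^esub> (c \<otimes>\<^bsub>R\<^esub> b))}"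

definition local_at :: "('a, 'b) ring_scheme \<Rightarrow> 'a set \<Rightarrow> ('a \<times> 'a) set ring" where
  "local_at R P =
    \<lparr>carrier = {fraction R P a b | a b. a \<in> carrier R \<and> b \<in> carrier R - P},
     mult = (\<lambda>x y. \<Union>(a, b)\<in>x. \<Union>(c, d)\<in>y. fraction R P (a \<otimes>\<^bsub>R\<^esub> c) (b \<otimes>\<^bsub>R\<^esub> d)),
     one = fraction R P \<one>\<^bsub>R\<^esub> \<one>\<^bsub>R\<^esub>,
     zero = fraction R P \<zero>\<^bsub>R\<^esub> \<one>\<^bsub>R\<^esub>,
     add = (\<lambda>x y. \<Union>(a, b)\<in>x. \<Union>(c, d)\<in>y.
              fraction R P (a \<otimes>\<^bsub>R\<^esub> d \<oplus>\<^bsub>R\<^esub> c \<otimes>\<^bsub>R\<^esub> b) (b \<otimes>\<^bsub>R\<^esub> d))\<rparr>"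

subsection \<open>Standard smooth algebras over the integers\<close>

type_synonym zpoly = "(nat \<Rightarrow>\<^sub>0 nat) \<Rightarrow>\<^sub>0 int"

definition zpolys :: "nat \<Rightarrow> zpoly set" where
  "zpolys n = {f. \<forall>m\<in>Poly_Mapping.keys f. Poly_Mapping.keys m \<subseteq> {..<n}}"

definition zpoly_eval :: "('a, 'b) ring_scheme \<Rightarrow> (nat \<Rightarrow> 'a) \<Rightarrow> zpoly \<Rightarrow> 'a" where
  "zpoly_eval R y f = (\<Oplus>\<^bsub>R\<^esub>m\<in>Poly_Mapping.keys f. [Poly_Mapping.lookup f m] \<cdot>\<^bsub>R\<^esub>
      (\<Otimes>\<^bsub>R\<^esub>i\<in>Poly_Mapping.keys m. y i [^]\<^bsub>R\<^esub> Poly_Mapping.lookup m i))"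

definition zpoly_deriv :: "nat \<Rightarrow> zpoly \<Rightarrow> zpoly" where
  "zpoly_deriv i f = (\<Sum>m\<in>Poly_Mapping.keys f. Poly_Mapping.single (m - Poly_Mapping.single i 1)
      (Poly_Mapping.lookup f m * int (Poly_Mapping.lookup m i)))"

definition jacobian_minor :: "nat \<Rightarrow> (nat \<Rightarrow> zpoly) \<Rightarrow> zpoly" where
  "jacobian_minor c f = (\<Sum>\<pi> | \<pi> permutes {..<c}. of_int (sign \<pi>) * (\<Prod>i<c. zpoly_deriv (\<pi> i) (f i)))"

text \<open>\<open>R\<close> is isomorphic to \<open>\<int>[t\<^sub>0, \<dots>, t\<^sub>n\<^sub>-\<^sub>1]/(f\<^sub>0, \<dots>, f\<^sub>c\<^sub>-\<^sub>1)\<close>, with \<open>t\<^sub>i\<close> going to \<open>y i\<close>, and the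
  determinant of the partial derivatives of the \<open>f\<^sub>i\<close> by the first \<open>c\<close> variables is a unit
  in \<open>R\<close>.\<close>

definition standard_smooth :: "('a, 'b) ring_scheme \<Rightarrow> bool" where
  "standard_smooth R \<longleftrightarrow> (\<exists>n c y f. c \<le> n \<and> (\<forall>i<n. y i \<in> carrier R) \<and> (\<forall>i<c. f i \<in> zpolys n) \<and>
     zpoly_eval R y ` zpolys n = carrier R \<and>
     {h \<in> zpolys n. zpoly_eval R y h = \<zero>\<^bsub>R\<^esub>} = {(\<Sum>i<c. g i * f i) | g. \<forall>i<c. g i \<in> zpolys n} \<and>
     zpoly_eval R y (jacobian_minor c f) \<in> Units R)"

subsection \<open>Lambda-rings\<close>

definition lambda_ring :: "('a, 'b) ring_scheme \<Rightarrow> (nat \<Rightarrow> 'a \<Rightarrow> 'a) \<Rightarrow> bool" where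
  "lambda_ring A \<psi> \<longleftrightarrow> cring A \<and> Z_flat_ring A \<and>
     (\<forall>p. Factorial_Ring.prime p \<longrightarrow> \<psi> p \<in> ring_hom A A) \<and>
     (\<forall>p q. Factorial_Ring.prime p \<and> Factorial_Ring.prime q \<longrightarrow>
        (\<forall>a\<in>carrier A. \<psi> p (\<psi> q a) = \<psi> q (\<psi> p a))) \<and>
     (\<forall>p. Factorial_Ring.prime p \<longrightarrow>
        (\<forall>a\<in>carrier A. \<exists>b\<in>carrier A. \<psi> p a \<ominus>\<^bsub>A\<^esub> a [^]\<^bsub>A\<^esub> p = [p] \<cdot>\<^bsub>A\<^esub> b))"

section \<open>Schemes\<close>

record ('x, 'a) space_data =
  topo :: "'x topology"
  sec :: "'x set \<Rightarrow> 'a ring"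
  res :: "'x set \<Rightarrow> 'x set \<Rightarrow> 'a \<Rightarrow> 'a"

text \<open>\<open>res X U V\<close> restricts sections from \<open>U\<close> to \<open>V\<close>.\<close>

locale ringed_space =
  fixes X :: "('x, 'a) space_data"
  assumes sec_cring: "openin (topo X) U \<Longrightarrow> cring (sec X U)"
    and res_hom: "\<lbrakk>openin (topo X) U; openin (topo X) V; V \<subseteq> U\<rbrakk> \<Longrightarrow> res X U V \<in> ring_hom (sec X U) (sec X V)"
    and res_id: "\<lbrakk>openin (topo X) U; s \<in> carrier (sec X U)\<rbrakk> \<Longrightarrow> res X U U s = s"
    and res_comp: "\<lbrakk>openin (topo X) U; openin (topo X) V; openin (topo X) W; W \<subseteq> V; V \<subseteq> U;
        s \<in> carrier (sec X U)\<rbrakk> \<Longrightarrow> res X V W (res X U V s) = res X U W s"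
    and locality: "\<lbrakk>\<And>V. V \<in> \<V> \<Longrightarrow> openin (topo X) V; s \<in> carrier (sec X (\<Union>\<V>)); t \<in> carrier (sec X (\<Union>\<V>));
        \<And>V. V \<in> \<V> \<Longrightarrow> res X (\<Union>\<V>) V s = res X (\<Union>\<V>) V t\<rbrakk> \<Longrightarrow> s = t"
    and gluing: "\<lbrakk>\<And>V. V \<in> \<V> \<Longrightarrow> openin (topo X) V; \<And>V. V \<in> \<V> \<Longrightarrow> \<sigma> V \<in> carrier (sec X V);
        \<And>V W. \<lbrakk>V \<in> \<V>; W \<in> \<V>\<rbrakk> \<Longrightarrow> res X V (V \<inter> W) (\<sigma> V) = res X W (V \<inter> W) (\<sigma> W)\<rbrakk>
        \<Longrightarrow> \<exists>s\<in>carrier (sec X (\<Union>\<V>)). \<forall>V\<in>\<V>. res X (\<Union>\<V>) V s = \<sigma> V"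

definition germ :: "('x, 'a) space_data \<Rightarrow> 'x \<Rightarrow> 'x set \<Rightarrow> 'a \<Rightarrow> ('x set \<times> 'a) set" where
  "germ X x U s = {(V, t). openin (topo X) V \<and> x \<in> V \<and> t \<in> carrier (sec X V) \<and>
     (\<exists>W. openin (topo X) W \<and> x \<in> W \<and> W \<subseteq> U \<inter> V \<and> res X U W s = res X V W t)}"

definition stalk :: "('x, 'a) space_data \<Rightarrow> 'x \<Rightarrow> ('x set \<times> 'a) set ring" where
  "stalk X x =
    \<lparr>carrier = {germ X x U s | U s. openin (topo X) U \<and> x \<in> U \<and> s \<in> carrier (sec X U)},
     mult = (\<lambda>g h. \<Union>(U, s)\<in>g. \<Union>(V, t)\<in>h.
               germ X x (U \<inter> V) (res X U (U \<inter> V) s \<otimes>\<^bsub>sec X (U \<inter> V)\<^esub> res X V (U \<inter> V) t)),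
     one = germ X x (topspace (topo X)) \<one>\<^bsub>sec X (topspace (topo X))\<^esub>,
     zero = germ X x (topspace (topo X)) \<zero>\<^bsub>sec X (topspace (topo X))\<^esub>,
     add = (\<lambda>g h. \<Union>(U, s)\<in>g. \<Union>(V, t)\<in>h.
               germ X x (U \<inter> V) (res X U (U \<inter> V) s \<oplus>\<^bsub>sec X (U \<inter> V)\<^esub> res X V (U \<inter> V) t))\<rparr>"

locale locally_ringed_space = ringed_space X for X :: "('x, 'a) space_data" +
  assumes stalk_local: "x \<in> topspace (topo X) \<Longrightarrow> local_ring (stalk X x)"

definition open_subspace :: "('x, 'a) space_data \<Rightarrow> 'x set \<Rightarrow> ('x, 'a) space_data" where
  "open_subspace X U = \<lparr>topo = subtopology (topo X) U, sec = sec X, res = res X\<rparr>"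

text \<open>A morphism \<open>X \<rightarrow> Y\<close> is a map of points together with ring homomorphisms
  \<open>comorph F V : \<O>\<^sub>Y(V) \<rightarrow> \<O>\<^sub>X(F\<^sup>-\<^sup>1(V))\<close>.\<close>

record ('x, 'a, 'y, 'b) morph_data =
  pts :: "'x \<Rightarrow> 'y"
  comorph :: "'y set \<Rightarrow> 'b \<Rightarrow> 'a"

definition preim :: "('x, 'a) space_data \<Rightarrow> ('x, 'a, 'y, 'b) morph_data \<Rightarrow> 'y set \<Rightarrow> 'x set" where
  "preim X F V = {x \<in> topspace (topo X). pts F x \<in> V}"

definition lrs_morphism ::
  "('x, 'a) space_data \<Rightarrow> ('y, 'b) space_data \<Rightarrow> ('x, 'a, 'y, 'b) morph_data \<Rightarrow> bool" where
  "lrs_morphism X Y F \<longleftrightarrow> continuous_map (topo X) (topo Y) (pts F) \<and>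
     (\<forall>V. openin (topo Y) V \<longrightarrow> comorph F V \<in> ring_hom (sec Y V) (sec X (preim X F V))) \<and>
     (\<forall>V W. openin (topo Y) V \<and> openin (topo Y) W \<and> W \<subseteq> V \<longrightarrow> (\<forall>s\<in>carrier (sec Y V).
        comorph F W (res Y V W s) = res X (preim X F V) (preim X F W) (comorph F V s))) \<and>
     (\<forall>x\<in>topspace (topo X). \<forall>V. openin (topo Y) V \<and> pts F x \<in> V \<longrightarrow> (\<forall>s\<in>carrier (sec Y V).
        germ Y (pts F x) V s \<in> max_ideal (stalk Y (pts F x)) \<longrightarrow>
        germ X x (preim X F V) (comorph F V s) \<in> max_ideal (stalk X x)))"

definition lrs_iso ::
  "('x, 'a) space_data \<Rightarrow> ('y, 'b) space_data \<Rightarrow> ('x, 'a, 'y, 'b) morph_data \<Rightarrow> bool" where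
  "lrs_iso X Y F \<longleftrightarrow> lrs_morphism X Y F \<and> homeomorphic_map (topo X) (topo Y) (pts F) \<and>
     (\<forall>V. openin (topo Y) V \<longrightarrow> comorph F V \<in> ring_iso (sec Y V) (sec X (preim X F V)))"

subsection \<open>Spectra\<close>

definition zariski :: "('a, 'b) ring_scheme \<Rightarrow> 'a set topology" where
  "zariski R = topology_generated_by {{P. primeideal P R \<and> f \<notin> P} | f. f \<in> carrier R}"

definition spec_sections :: "('a, 'b) ring_scheme \<Rightarrow> 'a set set \<Rightarrow> ('a set \<Rightarrow> ('a \<times> 'a) set) set" where
  "spec_sections R U = {\<sigma> \<in> (\<Pi>\<^sub>E P\<in>U. carrier (local_at R P)).
     \<forall>P\<in>U. \<exists>V a b. openin (zariski R) V \<and> P \<in> V \<and> V \<subseteq> U \<and> a \<in> carrier R \<and> b \<in> carrier R \<and>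
        (\<forall>Q\<in>V. b \<notin> Q \<and> \<sigma> Q = fraction R Q a b)}"

definition Spec :: "('a, 'b) ring_scheme \<Rightarrow> ('a set, 'a set \<Rightarrow> ('a \<times> 'a) set) space_data" where
  "Spec R =
    \<lparr>topo = zariski R,
     sec = (\<lambda>U. \<lparr>carrier = spec_sections R U,
       mult = (\<lambda>\<sigma> \<tau>. \<lambda>P\<in>U. \<sigma> P \<otimes>\<^bsub>local_at R P\<^esub> \<tau> P),
       one = (\<lambda>P\<in>U. \<one>\<^bsub>local_at R P\<^esub>),
       zero = (\<lambda>P\<in>U. \<zero>\<^bsub>local_at R P\<^esub>),
       add = (\<lambda>\<sigma> \<tau>. \<lambda>P\<in>U. \<sigma> P \<oplus>\<^bsub>local_at R P\<^esub> \<tau> P)\<rparr>),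
     res = (\<lambda>U V \<sigma>. restrict \<sigma> V)\<rparr>"

definition affine_open :: "('x, 'a) space_data \<Rightarrow> 'x set \<Rightarrow> bool" where
  "affine_open X U \<longleftrightarrow> openin (topo X) U \<and> (\<exists>F. lrs_iso (open_subspace X U) (Spec (sec X U)) F)"

locale scheme = locally_ringed_space X for X :: "('x, 'a) space_data" +
  assumes locally_affine: "x \<in> topspace (topo X) \<Longrightarrow> \<exists>U. x \<in> U \<and> affine_open X U"

definition noetherian_scheme :: "('x, 'a) space_data \<Rightarrow> bool" where
  "noetherian_scheme X \<longleftrightarrow> scheme X \<and>
     (\<exists>\<U>. finite \<U> \<and> (\<forall>U\<in>\<U>. affine_open X U \<and> noetherian_ring (sec X U)) \<and> \<Union>\<U> = topspace (topo X))"

definition Z_flat_scheme :: "('x, 'a) space_data \<Rightarrow> bool" where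
  "Z_flat_scheme X \<longleftrightarrow> scheme X \<and> (\<forall>x\<in>topspace (topo X). Z_flat_ring (stalk X x))"

text \<open>Smooth over \<open>Spec \<int>\<close>. Every scheme has exactly one morphism to \<open>Spec \<int>\<close>, so the
  morphism is not part of the data.\<close>

definition Z_smooth_scheme :: "('x, 'a) space_data \<Rightarrow> bool" where
  "Z_smooth_scheme X \<longleftrightarrow> scheme X \<and>
     (\<forall>x\<in>topspace (topo X). \<exists>U. x \<in> U \<and> affine_open X U \<and> standard_smooth (sec X U))"

text \<open>The locus \<open>D(f)\<close> in \<open>U\<close> where \<open>f\<close> is invertible.\<close>

definition dist_open :: "('x, 'a) space_data \<Rightarrow> 'x set \<Rightarrow> 'a \<Rightarrow> 'x set" where
  "dist_open X U f = {x \<in> U. germ X x U f \<notin> max_ideal (stalk X x)}"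

section \<open>Lambda-schemes\<close>

text \<open>On a \<open>\<int>\<close>-flat scheme an action of \<open>W\<^sup>*\<close> is a commuting family of endomorphisms
  \<open>\<Psi> p\<close>, one for each prime \<open>p\<close>, such that \<open>\<Psi> p\<close> restricts to the Frobenius map on the
  fibre over \<open>p\<close>: it fixes the points of this fibre, and on functions it is the \<open>p\<close>-th power
  modulo \<open>p\<close>. The equation of comorphisms is that of \<open>\<Psi> p \<circ> \<Psi> q\<close> and
  \<open>\<Psi> q \<circ> \<Psi> p\<close>.\<close>

definition lambda_scheme ::
  "('x, 'a) space_data \<Rightarrow> (nat \<Rightarrow> ('x, 'a, 'x, 'a) morph_data) \<Rightarrow> bool" where
  "lambda_scheme X \<Psi> \<longleftrightarrow> Z_flat_scheme X \<and>
     (\<forall>p. Factorial_Ring.prime p \<longrightarrow> lrs_morphism X X (\<Psi> p)) \<and>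
     (\<forall>p q. Factorial_Ring.prime p \<and> Factorial_Ring.prime q \<longrightarrow>
        (\<forall>x\<in>topspace (topo X). pts (\<Psi> p) (pts (\<Psi> q) x) = pts (\<Psi> q) (pts (\<Psi> p) x)) \<and>
        (\<forall>U s. openin (topo X) U \<and> s \<in> carrier (sec X U) \<longrightarrow>
           comorph (\<Psi> q) (preim X (\<Psi> p) U) (comorph (\<Psi> p) U s) =
           comorph (\<Psi> p) (preim X (\<Psi> q) U) (comorph (\<Psi> q) U s))) \<and>
     (\<forall>p. Factorial_Ring.prime p \<longrightarrow> (\<forall>x\<in>topspace (topo X).
        [p] \<cdot>\<^bsub>stalk X x\<^esub> \<one>\<^bsub>stalk X x\<^esub> \<in> max_ideal (stalk X x) \<longrightarrow>
        pts (\<Psi> p) x = x \<and>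
        (\<forall>U s. openin (topo X) U \<and> x \<in> U \<and> s \<in> carrier (sec X U) \<longrightarrow>
           (\<exists>b\<in>carrier (stalk X x).
              germ X x (preim X (\<Psi> p) U) (comorph (\<Psi> p) U s) \<ominus>\<^bsub>stalk X x\<^esub>
                germ X x U s [^]\<^bsub>stalk X x\<^esub> p = [p] \<cdot>\<^bsub>stalk X x\<^esub> b))))"

text \<open>An affine \<open>\<Lambda>\<close>-cover \<open>X = \<Union>\<^sub>i\<^sub>\<in>\<^sub>C Spec A\<^sub>i\<close>, where \<open>Spec A\<^sub>i\<close> is \<open>U i\<close> and \<open>\<psi> i\<close> is
  the \<open>\<Lambda>\<close>-structure on \<open>A\<^sub>i\<close>. The last conjunct says that \<open>\<Psi>\<close> is glued from
  the \<open>\<psi> i\<close>.\<close>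

definition affine_lambda_cover ::
  "('x, 'a) space_data \<Rightarrow> (nat \<Rightarrow> ('x, 'a, 'x, 'a) morph_data) \<Rightarrow>
   'i set \<Rightarrow> ('i \<Rightarrow> 'x set) \<Rightarrow> ('i \<Rightarrow> nat \<Rightarrow> 'a \<Rightarrow> 'a) \<Rightarrow> bool" where
  "affine_lambda_cover X \<Psi> C U \<psi> \<longleftrightarrow>
     (\<forall>i\<in>C. affine_open X (U i) \<and> lambda_ring (sec X (U i)) (\<psi> i)) \<and>
     (\<Union>i\<in>C. U i) = topspace (topo X) \<and>
     (\<forall>i\<in>C. \<forall>j\<in>C. \<forall>x\<in>U i \<inter> U j. \<exists>V \<phi>. x \<in> V \<and> V \<subseteq> U i \<inter> U j \<and>
        affine_open X V \<and> lambda_ring (sec X V) \<phi> \<and>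
        (\<exists>f\<in>carrier (sec X (U i)). V = dist_open X (U i) f) \<and>
        (\<exists>g\<in>carrier (sec X (U j)). V = dist_open X (U j) g) \<and>
        (\<forall>p. Factorial_Ring.prime p \<longrightarrow>
           (\<forall>s\<in>carrier (sec X (U i)). res X (U i) V (\<psi> i p s) = \<phi> p (res X (U i) V s)) \<and>
           (\<forall>s\<in>carrier (sec X (U j)). res X (U j) V (\<psi> j p s) = \<phi> p (res X (U j) V s)))) \<and>
     (\<forall>i\<in>C. \<forall>p. Factorial_Ring.prime p \<longrightarrow> pts (\<Psi> p) ` U i \<subseteq> U i \<and>
        (\<forall>s\<in>carrier (sec X (U i)).
           res X (preim X (\<Psi> p) (U i)) (U i) (comorph (\<Psi> p) (U i) s) = \<psi> i p s))"

section \<open>Ideal sheaves\<close>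

type_synonym ('x, 'a) ideal_data = "'x set \<Rightarrow> 'a set"

definition ideal_sheaf :: "('x, 'a) space_data \<Rightarrow> ('x, 'a) ideal_data \<Rightarrow> bool" where
  "ideal_sheaf X I \<longleftrightarrow>
     (\<forall>U. openin (topo X) U \<longrightarrow> ideal (I U) (sec X U)) \<and>
     (\<forall>U V. openin (topo X) U \<and> openin (topo X) V \<and> V \<subseteq> U \<longrightarrow> res X U V ` I U \<subseteq> I V) \<and>
     (\<forall>U s. openin (topo X) U \<and> s \<in> carrier (sec X U) \<and>
        (\<forall>x\<in>U. \<exists>V. openin (topo X) V \<and> x \<in> V \<and> V \<subseteq> U \<and> res X U V s \<in> I V) \<longrightarrow> s \<in> I U)"

text \<open>Near each point, \<open>I\<close> is the sheaf on an affine open \<open>U\<close> associated to a finitely generated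
  ideal \<open>I U\<close>; on \<open>D(f)\<close> this sheaf has the sections \<open>(I U)\<^sub>f\<close>, the ideal of \<open>\<O>(U)\<^sub>f = \<O>(D(f))\<close>
  generated by \<open>I U\<close>.\<close>

definition coherent_ideal :: "('x, 'a) space_data \<Rightarrow> ('x, 'a) ideal_data \<Rightarrow> bool" where
  "coherent_ideal X I \<longleftrightarrow> ideal_sheaf X I \<and>
     (\<forall>x\<in>topspace (topo X). \<exists>U. x \<in> U \<and> affine_open X U \<and>
        (\<exists>S. finite S \<and> S \<subseteq> carrier (sec X U) \<and> I U = Idl\<^bsub>sec X U\<^esub> S) \<and>
        (\<forall>f\<in>carrier (sec X U).
           I (dist_open X U f) = Idl\<^bsub>sec X (dist_open X U f)\<^esub> (res X U (dist_open X U f) ` I U)))"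

definition stalk_ideal :: "('x, 'a) space_data \<Rightarrow> ('x, 'a) ideal_data \<Rightarrow> 'x \<Rightarrow> ('x set \<times> 'a) set set" where
  "stalk_ideal X I x = {germ X x U s | U s. openin (topo X) U \<and> x \<in> U \<and> s \<in> I U}"

text \<open>The points of the closed subscheme \<open>V(I)\<close>. Its local ring at \<open>x\<close> is
  \<open>\<O>\<^sub>X\<^sub>,\<^sub>x/I\<^sub>x\<close>.\<close>

definition zero_locus :: "('x, 'a) space_data \<Rightarrow> ('x, 'a) ideal_data \<Rightarrow> 'x set" where
  "zero_locus X I = {x \<in> topspace (topo X). stalk_ideal X I x \<noteq> carrier (stalk X x)}"

text \<open>\<open>I\<close> and the ideal sheaf \<open>e\<O>\<^sub>U\<close> agree on \<open>U\<close>, i.e. have the same stalks there.\<close>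

definition defined_by_on :: "('x, 'a) space_data \<Rightarrow> ('x, 'a) ideal_data \<Rightarrow> 'x set \<Rightarrow> 'a \<Rightarrow> bool" where
  "defined_by_on X I U e \<longleftrightarrow> (\<forall>x\<in>U. stalk_ideal X I x = PIdl\<^bsub>stalk X x\<^esub> (germ X x U e))"

definition order_at :: "('x, 'a) space_data \<Rightarrow> ('x, 'a) ideal_data \<Rightarrow> 'x \<Rightarrow> enat" where
  "order_at X I x = Sup {enat n | n. stalk_ideal X I x \<subseteq> max_ideal (stalk X x) [^]\<^bsub>ideals_set (stalk X x)\<^esub> n}"

definition order_supp :: "('x, 'a) space_data \<Rightarrow> ('x, 'a) ideal_data \<Rightarrow> nat \<Rightarrow> 'x set" where
  "order_supp X I m = {x \<in> topspace (topo X). order_at X I x \<ge> enat m}"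

definition upper_semicontinuous_on :: "'x topology \<Rightarrow> ('x \<Rightarrow> 'b::linorder) \<Rightarrow> bool" where
  "upper_semicontinuous_on T f \<longleftrightarrow> (\<forall>b. openin T {x \<in> topspace T. f x < b})"

section \<open>Divisors\<close>

text \<open>The divisor \<open>\<Sum>\<^sub>j\<^sub>\<in>\<^sub>J E\<^sup>j\<close> is given by the ideal sheaves \<open>E j\<close> of its components.\<close>

definition snc_divisor :: "('x, 'a) space_data \<Rightarrow> 'j set \<Rightarrow> ('j \<Rightarrow> ('x, 'a) ideal_data) \<Rightarrow> bool" where
  "snc_divisor X J E \<longleftrightarrow>
     (\<forall>j\<in>J. coherent_ideal X (E j)) \<and>
     (\<forall>j\<in>J. \<forall>k\<in>J. j \<noteq> k \<longrightarrow> (\<exists>U. openin (topo X) U \<and> E j U \<noteq> E k U)) \<and>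
     (\<forall>j\<in>J. \<forall>x\<in>zero_locus X (E j). regular_local_ring (stalk X x Quot stalk_ideal X (E j) x)) \<and>
     (\<forall>x\<in>topspace (topo X). \<exists>xs c. regular_parameters (stalk X x) xs \<and>
        inj_on c {j \<in> J. x \<in> zero_locus X (E j)} \<and>
        (\<forall>j\<in>J. x \<in> zero_locus X (E j) \<longrightarrow> c j < length xs \<and>
           (\<exists>U e. openin (topo X) U \<and> x \<in> U \<and> e \<in> carrier (sec X U) \<and>
              germ X x U e = xs ! c j \<and> defined_by_on X (E j) U e)))"

definition Z_flat_divisor :: "('x, 'a) space_data \<Rightarrow> 'j set \<Rightarrow> ('j \<Rightarrow> ('x, 'a) ideal_data) \<Rightarrow> bool" where
  "Z_flat_divisor X J E \<longleftrightarrow>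
     (\<forall>j\<in>J. \<forall>x\<in>zero_locus X (E j). Z_flat_ring (stalk X x Quot stalk_ideal X (E j) x))"

definition locally_toric ::
  "('x, 'a) space_data \<Rightarrow> 'i set \<Rightarrow> ('i \<Rightarrow> 'x set) \<Rightarrow> ('i \<Rightarrow> nat \<Rightarrow> 'a \<Rightarrow> 'a) \<Rightarrow>
   'j set \<Rightarrow> ('j \<Rightarrow> ('x, 'a) ideal_data) \<Rightarrow> bool" where
  "locally_toric X C U \<psi> J E \<longleftrightarrow>
     (\<forall>i\<in>C. \<exists>e. permutable_regular (sec X (U i)) {j \<in> J. zero_locus X (E j) \<inter> U i \<noteq> {}} e \<and>
        (\<forall>j\<in>J. zero_locus X (E j) \<inter> U i \<noteq> {} \<longrightarrow> e j \<in> carrier (sec X (U i)) \<and>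
           defined_by_on X (E j) (U i) (e j) \<and>
           (\<forall>p. Factorial_Ring.prime p \<longrightarrow> \<psi> i p (e j) = e j [^]\<^bsub>sec X (U i)\<^esub> p)))"

text \<open>\<open>\<O>\<^sub>X(- \<Sum>\<^sub>i\<^sub>\<in>\<^sub>S a\<^sub>i E\<^sup>i)\<close>, the ideal sheaf with stalks \<open>\<Prod>\<^sub>i\<^sub>\<in>\<^sub>S (E i)\<^sub>x ^ a\<^sub>i\<close>.\<close>

definition monomial_ideal ::
  "('x, 'a) space_data \<Rightarrow> ('j \<Rightarrow> ('x, 'a) ideal_data) \<Rightarrow> 'j set \<Rightarrow> ('j \<Rightarrow> nat) \<Rightarrow> ('x, 'a) ideal_data" where
  "monomial_ideal X E S a U = {s \<in> carrier (sec X U). \<forall>x\<in>U. germ X x U s \<in>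
     (\<Otimes>\<^bsub>ideals_set (stalk X x)\<^esub>i\<in>S. stalk_ideal X (E i) x [^]\<^bsub>ideals_set (stalk X x)\<^esub> a i)}"

text \<open>\<open>\<Sum>\<^sub>k\<^sub><\<^sub>r F k\<close> as a sheaf.\<close>

definition sum_ideal :: "('x, 'a) space_data \<Rightarrow> nat \<Rightarrow> (nat \<Rightarrow> ('x, 'a) ideal_data) \<Rightarrow> ('x, 'a) ideal_data" where
  "sum_ideal X r F U = {s \<in> carrier (sec X U). \<forall>x\<in>U. germ X x U s \<in>
     (\<Oplus>\<^bsub>ideals_set (stalk X x)\<^esub>k\<in>{..<r}. stalk_ideal X (F k) x)}"

definition locally_generated_by_monomials ::
  "('x, 'a) space_data \<Rightarrow> 'j set \<Rightarrow> ('j \<Rightarrow> ('x, 'a) ideal_data) \<Rightarrow> ('x, 'a) ideal_data \<Rightarrow> bool" where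
  "locally_generated_by_monomials X J E I \<longleftrightarrow>
     (\<exists>r S a. (\<forall>k<r. finite (S k) \<and> S k \<subseteq> J) \<and>
        (\<forall>U. openin (topo X) U \<longrightarrow> I U = sum_ideal X r (\<lambda>k. monomial_ideal X E (S k) (a k)) U))"

end

theory Submission
  imports Defs
begin

text \<open>
  Let \<open>d\<^sub>k(x)\<close> be the sum of the exponents, in the \<open>k\<close>-th monomial, of the components through \<open>x\<close>.
  Then \<open>ord\<^sub>x I\<close> is the minimum of the \<open>d\<^sub>k(x)\<close>, and each \<open>d\<^sub>k\<close> is upper semicontinuous because the
  components are closed. That the order is not larger than \<open>d\<^sub>k(x)\<close> rests on the fact that a monomial
  of degree \<open>d\<close> in a regular system of parameters of a local ring is not in the power \<open>d + 1\<close> of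
  the maximal ideal, which follows from Krull's height theorem.
\<close>

section \<open>Saturated ideals\<close>

text \<open>Membership in \<open>I W\<close> is tested at every point of \<open>W\<close>, whereas a
  monomial in the parameters is a priori a single germ at \<open>x\<close>. The upper bound on the
  order therefore needs a section near \<open>x\<close> all of whose germs lie in the prescribed
  products of ideals. It is a product of local equations of the components through \<open>x\<close>
  and of the constant one off the other components. The lower bound uses only inclusions between
  ideals of one stalk.

  Only one monomial at a time is tested against powers of the maximal ideal, so all parameters may
  be specialised to one of them. What remains is a count: the maximal ideal is not a minimal prime
  over fewer elements than the dimension.

  Krull's theorem is proved without ever changing the ring. Localizing at \<open>P\<close> becomes
  saturating at \<open>P\<close>, and dividing by a prime \<open>P0\<close> becomes carrying
  \<open>P0\<close> as a summand of every ideal.\<close>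

context ring
begin

lemmas ideal_zero_mem = additive_subgroup.zero_closed[OF ideal.axioms(1)]
lemmas ideal_add_mem = additive_subgroup.a_closed[OF ideal.axioms(1)]

lemma ideal_subset: "ideal A R \<Longrightarrow> A \<subseteq> carrier R"
  using additive_subgroup.a_subset ideal.axioms(1) by blast

lemma ideal_minus_mem:
  assumes "ideal A R" "a \<in> A" "b \<in> A"
  shows "a \<ominus> b \<in> A"
  using additive_subgroup.a_inv_closed[OF ideal.axioms(1)[OF assms(1)] assms(3)]
    ideal_add_mem[OF assms(1,2)] by (simp add: a_minus_def)

lemma ideal_add_cancel:
  assumes "ideal A R" "l \<in> A" "a \<in> carrier R" "l \<oplus> a \<in> A"
  shows "a \<in> A"
proof -
  have l: "l \<in> carrier R"
    using assms(1,2) ideal_subset by blast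
  have "(l \<oplus> a) \<ominus> l \<in> A"
    using ideal_minus_mem[OF assms(1,4,2)] .
  moreover have "(l \<oplus> a) \<ominus> l = a"
    using l assms(3) by (simp add: a_minus_def a_ac r_neg)
  ultimately show ?thesis by simp
qed

end

context cring
begin

text \<open>Negatives come for free, as multiples by \<open>\<ominus> \<one>\<close>.\<close>

lemma cring_idealI:
  assumes "A \<subseteq> carrier R" "\<zero> \<in> A"
    and "\<And>a b. \<lbrakk>a \<in> A; b \<in> A\<rbrakk> \<Longrightarrow> a \<oplus> b \<in> A"
    and "\<And>r a. \<lbrakk>r \<in> carrier R; a \<in> A\<rbrakk> \<Longrightarrow> r \<otimes> a \<in> A"
  shows "ideal A R"
proof (rule idealI[OF ring_axioms])
  show "subgroup A (add_monoid R)"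
  proof (rule add.subgroupI)
    fix a assume a: "a \<in> A"
    hence "\<ominus> a = (\<ominus> \<one>) \<otimes> a"
      using assms(1) l_minus[of \<one> a] by (simp add: subsetD)
    thus "\<ominus> a \<in> A" using assms(4) a by simp
  qed (use assms in auto)
next
  fix a x assume "a \<in> A" "x \<in> carrier R"
  thus "x \<otimes> a \<in> A" "a \<otimes> x \<in> A"
    using assms(1,4) m_comm[of a x] by (auto simp: subsetD)
qed

lemma mem_add_cgenideal:
  assumes "B \<subseteq> carrier R" "c \<in> carrier R"
  shows "a \<in> B <+>\<^bsub>R\<^esub> PIdl c \<longleftrightarrow> (\<exists>b\<in>B. \<exists>r\<in>carrier R. a = b \<oplus> r \<otimes> c)"
  unfolding set_add_def' cgenideal_def by auto

lemma ideal_add_cgenideal: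
  assumes "ideal B R" "c \<in> carrier R"
  shows "ideal (B <+>\<^bsub>R\<^esub> PIdl c) R" "B \<subseteq> B <+>\<^bsub>R\<^esub> PIdl c" "c \<in> B <+>\<^bsub>R\<^esub> PIdl c"
proof -
  have B: "B \<subseteq> carrier R" using ideal_subset[OF assms(1)] .
  show "ideal (B <+>\<^bsub>R\<^esub> PIdl c) R"
    using assms add_ideals cgenideal_ideal by blast
  show "B \<subseteq> B <+>\<^bsub>R\<^esub> PIdl c"
  proof
    fix b assume "b \<in> B"
    moreover from this have "b = b \<oplus> \<zero> \<otimes> c" using B assms(2) by auto
    ultimately show "b \<in> B <+>\<^bsub>R\<^esub> PIdl c"
      using mem_add_cgenideal[OF B assms(2)] by blast
  qed
  have "c = \<zero> \<oplus> \<one> \<otimes> c" using assms(2) by simp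
  thus "c \<in> B <+>\<^bsub>R\<^esub> PIdl c"
    using mem_add_cgenideal[OF B assms(2)] ideal_zero_mem[OF assms(1)] by blast
qed

lemma add_cgenideal_minimal:
  assumes "ideal A R" "B \<subseteq> A" "c \<in> A"
  shows "B <+>\<^bsub>R\<^esub> PIdl c \<subseteq> A"
  using assms unfolding set_add_def' cgenideal_def
  by (auto intro!: ideal_add_mem ideal.I_l_closed)

text \<open>The ideals \<open>saturation P A\<close> correspond to the ideals of the localization at \<open>P\<close>. Working
  with them replaces localizing the ring.\<close>

definition saturation :: "'a set \<Rightarrow> 'a set \<Rightarrow> 'a set" where
  "saturation P A = {a \<in> carrier R. \<exists>s\<in>carrier R - P. s \<otimes> a \<in> A}"

text \<open>The whole ring counts as saturated: it corresponds to the unit ideal of the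
  localization.\<close>

definition saturated :: "'a set \<Rightarrow> 'a set \<Rightarrow> bool" where
  "saturated P A \<longleftrightarrow> ideal A R \<and> (\<forall>s\<in>carrier R - P. \<forall>a\<in>carrier R. s \<otimes> a \<in> A \<longrightarrow> a \<in> A)"

lemma prime_compl_mult:
  assumes "primeideal P R" "s \<in> carrier R - P" "t \<in> carrier R - P"
  shows "s \<otimes> t \<in> carrier R - P"
  using assms primeideal.I_prime by fastforce

lemma prime_compl_one:
  assumes "primeideal P R"
  shows "\<one> \<in> carrier R - P"
  using assms ideal.one_imp_carrier primeideal.I_notcarr primeideal_def by fastforce

lemma prime_pow_mem:
  assumes "primeideal P R" "a \<in> carrier R" "a [^] (k::nat) \<in> P"
  shows "a \<in> P"
  using assms(3)
proof (induction k)
  case 0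
  thus ?case using prime_compl_one[OF assms(1)] by simp
next
  case (Suc k)
  thus ?case using primeideal.I_prime[OF assms(1), of "a [^] k" a] assms(2) by auto
qed

lemma saturation_superset:
  assumes "primeideal P R" "ideal A R"
  shows "A \<subseteq> saturation P A"
  using assms prime_compl_one unfolding saturation_def
  by (auto intro!: bexI[of _ \<one>] dest: ideal.Icarr)

lemma saturation_saturated:
  assumes P: "primeideal P R" and A: "ideal A R"
  shows "saturated P (saturation P A)"
  unfolding saturated_def
proof (intro conjI ballI impI)
  show "ideal (saturation P A) R"
  proof (rule cring_idealI)
    show "saturation P A \<subseteq> carrier R" by (auto simp: saturation_def)
    show "\<zero> \<in> saturation P A"
      using saturation_superset[OF P A] ideal_zero_mem[OF A] by blast
  next
    fix a b assume "a \<in> saturation P A" "b \<in> saturation P A"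
    then obtain s t where st: "s \<in> carrier R - P" "t \<in> carrier R - P" "s \<otimes> a \<in> A" "t \<otimes> b \<in> A"
      and ab: "a \<in> carrier R" "b \<in> carrier R"
      by (auto simp: saturation_def)
    \<comment> \<open>Common denominator \<open>s \<otimes> t\<close> for the two fractions.\<close>
    have "t \<otimes> (s \<otimes> a) \<oplus> s \<otimes> (t \<otimes> b) \<in> A"
      using st by (auto intro!: ideal_add_mem[OF A] ideal.I_l_closed[OF A])
    moreover have "t \<otimes> (s \<otimes> a) \<oplus> s \<otimes> (t \<otimes> b) = (s \<otimes> t) \<otimes> (a \<oplus> b)"
      using st ab by (simp add: r_distr m_ac)
    ultimately show "a \<oplus> b \<in> saturation P A"
      using prime_compl_mult[OF P st(1,2)] ab by (auto simp: saturation_def)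
  next
    fix r a assume r: "r \<in> carrier R" and "a \<in> saturation P A"
    then obtain s where s: "s \<in> carrier R - P" "s \<otimes> a \<in> A" and a: "a \<in> carrier R"
      by (auto simp: saturation_def)
    have "r \<otimes> (s \<otimes> a) \<in> A" using ideal.I_l_closed[OF A s(2) r] .
    hence "s \<otimes> (r \<otimes> a) \<in> A" using r s a by (simp add: m_ac)
    thus "r \<otimes> a \<in> saturation P A"
      using r a s by (auto simp: saturation_def)
  qed
  fix s a assume s: "s \<in> carrier R - P" and a: "a \<in> carrier R" and "s \<otimes> a \<in> saturation P A"
  then obtain t where t: "t \<in> carrier R - P" "t \<otimes> (s \<otimes> a) \<in> A"
    by (auto simp: saturation_def)
  hence "(t \<otimes> s) \<otimes> a \<in> A" using s a by (simp add: m_assoc)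
  thus "a \<in> saturation P A"
    using prime_compl_mult[OF P t(1) s] a by (auto simp: saturation_def)
qed

lemma saturation_minimal:
  assumes "saturated P B" "A \<subseteq> B"
  shows "saturation P A \<subseteq> B"
  using assms unfolding saturated_def saturation_def by blast

lemma saturatedD:
  assumes "saturated P A"
  shows "ideal A R" "\<And>s a. \<lbrakk>s \<in> carrier R - P; a \<in> carrier R; s \<otimes> a \<in> A\<rbrakk> \<Longrightarrow> a \<in> A"
  using assms unfolding saturated_def by auto

lemma saturation_mono: "A \<subseteq> B \<Longrightarrow> saturation P A \<subseteq> saturation P B"
  unfolding saturation_def by blast

text \<open>The working form of membership in the localized ideal generated by \<open>B\<close> and
  \<open>c\<close>: an equation in \<open>R\<close> itself, with the denominator \<open>s\<close>
  cleared. The arguments below compute with such equations.\<close>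

lemma mem_saturation_add_cgenideal:
  assumes "ideal B R" "c \<in> carrier R"
  shows "a \<in> saturation P (B <+>\<^bsub>R\<^esub> PIdl c) \<longleftrightarrow> a \<in> carrier R \<and>
    (\<exists>s\<in>carrier R - P. \<exists>b\<in>B. \<exists>r\<in>carrier R. s \<otimes> a = b \<oplus> r \<otimes> c)"
proof -
  have "B \<subseteq> carrier R" using ideal_subset[OF assms(1)] .
  thus ?thesis
    unfolding saturation_def using mem_add_cgenideal[OF _ assms(2)] by auto
qed

end

section \<open>Noetherian arguments with saturated ideals\<close>

locale noetherian_cring = cring R + noetherian_ring R for R (structure)

context noetherian_cring
begin

text \<open>In a Noetherian ring a nonempty chain of ideals contains its own union, so Zorn's lemma
  applies to every nonempty family of ideals.\<close>

lemma maximal_ideal_in: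
  assumes "\<F> \<noteq> {}" "\<And>A. A \<in> \<F> \<Longrightarrow> ideal A R"
  obtains M where "M \<in> \<F>" "\<And>A. \<lbrakk>A \<in> \<F>; M \<subseteq> A\<rbrakk> \<Longrightarrow> A = M"
proof -
  have "\<exists>M\<in>\<F>. \<forall>A\<in>\<F>. M \<subseteq> A \<longrightarrow> A = M"
  proof (rule subset_Zorn_nonempty[OF assms(1)])
    fix C assume C: "C \<noteq> {}" "subset.chain \<F> C"
    hence "subset.chain {I. ideal I R} C"
      using assms(2) unfolding pred_on.chain_def by auto
    hence "\<Union>C \<in> C" using C(1) ideal_chain_is_trivial by blast
    thus "\<Union>C \<in> \<F>" using C(2) unfolding pred_on.chain_def by auto
  qed
  thus ?thesis using that by blast
qed

text \<open>An ideal maximal among those that contain \<open>A\<close> and miss the multiplicative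
  set \<open>S\<close> is prime.\<close>

lemma exists_prime_disjoint:
  assumes A: "ideal A R" and S: "S \<subseteq> carrier R" "S \<noteq> {}" "A \<inter> S = {}"
    and S_mult: "\<And>s t. \<lbrakk>s \<in> S; t \<in> S\<rbrakk> \<Longrightarrow> s \<otimes> t \<in> S"
  obtains Q where "primeideal Q R" "A \<subseteq> Q" "Q \<inter> S = {}"
proof -
  let ?F = "{Q. ideal Q R \<and> A \<subseteq> Q \<and> Q \<inter> S = {}}"
  obtain Q where "Q \<in> ?F" and max: "\<And>B. \<lbrakk>B \<in> ?F; Q \<subseteq> B\<rbrakk> \<Longrightarrow> B = Q"
    using maximal_ideal_in[of ?F] A S by blast
  hence Q: "ideal Q R" "A \<subseteq> Q" "Q \<inter> S = {}" by auto
  have Qc: "Q \<subseteq> carrier R" using ideal_subset[OF Q(1)] .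
  \<comment> \<open>By maximality of \<open>Q\<close>, adjoining any \<open>u\<close> outside
    \<open>Q\<close> produces an ideal that meets \<open>S\<close>.\<close>
  have meets: "\<exists>q\<in>Q. \<exists>r\<in>carrier R. q \<oplus> r \<otimes> u \<in> S" if u: "u \<in> carrier R" "u \<notin> Q" for u
  proof (rule ccontr)
    assume *: "\<not> ?thesis"
    have "(Q <+>\<^bsub>R\<^esub> PIdl u) \<inter> S = {}"
      using * mem_add_cgenideal[OF Qc u(1)] by auto
    hence "Q <+>\<^bsub>R\<^esub> PIdl u \<in> ?F"
      using ideal_add_cgenideal[OF Q(1) u(1)] Q(2) by auto
    hence "Q <+>\<^bsub>R\<^esub> PIdl u = Q" using max ideal_add_cgenideal[OF Q(1) u(1)] by blast
    thus False using ideal_add_cgenideal[OF Q(1) u(1)] u(2) by blast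
  qed
  have "primeideal Q R"
  proof (rule primeidealI[OF Q(1) is_cring])
    show "carrier R \<noteq> Q" using Q(3) S by blast
    fix u v assume uv: "u \<in> carrier R" "v \<in> carrier R" "u \<otimes> v \<in> Q"
    show "u \<in> Q \<or> v \<in> Q"
    proof (rule ccontr)
      assume "\<not> ?thesis"
      then obtain q r q' r' where qr: "q \<in> Q" "r \<in> carrier R" "q \<oplus> r \<otimes> u \<in> S"
          "q' \<in> Q" "r' \<in> carrier R" "q' \<oplus> r' \<otimes> v \<in> S"
        using meets uv by metis
      hence qc: "q \<in> carrier R" "q' \<in> carrier R" using Qc by auto
      \<comment> \<open>This product of two elements of \<open>S\<close> is in \<open>S\<close>, but
        each of its four terms has a factor in \<open>Q\<close>.\<close>
      have "(q \<oplus> r \<otimes> u) \<otimes> (q' \<oplus> r' \<otimes> v) = q' \<otimes> q \<oplus> (r' \<otimes> v) \<otimes> q \<oplus> (r \<otimes> u) \<otimes> q' \<oplus> (r \<otimes> r') \<otimes> (u \<otimes> v)"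
        using qr qc uv by (simp add: l_distr r_distr m_ac a_ac)
      also have "\<dots> \<in> Q"
        using qr qc uv by (auto intro!: ideal_add_mem[OF Q(1)] ideal.I_l_closed[OF Q(1)])
      finally show False using S_mult[OF qr(3,6)] Q(3) by blast
    qed
  qed
  thus ?thesis using that Q by blast
qed

text \<open>In the localization at \<open>P\<close> modulo \<open>B\<close> the maximal ideal is
  nil. An element \<open>c\<close> outside \<open>B\<close> whose annihilator is as large as
  possible is then killed by \<open>P\<close>: for the least \<open>k\<close> with
  \<open>a [^] k \<otimes> c\<close> in \<open>B\<close>, the preceding product has the annihilator
  of \<open>c\<close> by maximality, and \<open>a\<close> belongs to it.\<close>

lemma saturated_socle:
  assumes P: "primeideal P R" and B: "saturated P B" "B \<noteq> carrier R"
    and rad: "\<And>a. a \<in> P \<Longrightarrow> \<exists>k::nat. \<exists>s\<in>carrier R - P. s \<otimes> a [^] k \<in> B"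
  obtains c where "c \<in> carrier R" "c \<notin> B" "\<And>a. a \<in> P \<Longrightarrow> a \<otimes> c \<in> B"
proof -
  note Bid = saturatedD(1)[OF B(1)]
  have Bc: "B \<subseteq> carrier R" using ideal_subset[OF Bid] .
  have Pc: "P \<subseteq> carrier R" using ideal_subset[OF primeideal.axioms(1)[OF P]] .
  define ann where "ann c = {r \<in> carrier R. c \<otimes> r \<in> B}" for c
  have ann: "ideal (ann c) R" if "c \<in> carrier R" for c
    unfolding ann_def using ideal.helper_max_prime[OF Bid is_cring that] .
  obtain c where c: "c \<in> carrier R" "c \<notin> B"
    and max: "\<And>c'. \<lbrakk>c' \<in> carrier R; c' \<notin> B; ann c \<subseteq> ann c'\<rbrakk> \<Longrightarrow> ann c' = ann c"
    using maximal_ideal_in[of "ann ` (carrier R - B)"] ann B(2) Bc by (smt (verit) Diff_iff Diff_eq_empty_iff image_iff image_is_empty subset_antisym)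
  have "a \<otimes> c \<in> B" if a: "a \<in> P" for a
  proof -
    have ac: "a \<in> carrier R" using a Pc by auto
    obtain k :: nat and s where s: "s \<in> carrier R - P" "s \<otimes> a [^] k \<in> B" using rad[OF a] by blast
    hence "s \<otimes> (a [^] k \<otimes> c) \<in> B"
      using ideal.I_r_closed[OF Bid s(2) c(1)] ac c(1) by (simp add: m_assoc)
    hence "a [^] k \<otimes> c \<in> B"
      using saturatedD(2)[OF B(1) s(1)] ac c(1) by auto
    thus ?thesis
    proof (induction k)
      case 0
      thus ?case using c by simp
    next
      case (Suc k)
      show ?case
      proof (cases "a [^] k \<otimes> c \<in> B")
        case False
        have "ann c \<subseteq> ann (a [^] k \<otimes> c)"
          unfolding ann_def using ac c(1) ideal.I_l_closed[OF Bid]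
          by (auto simp: m_assoc)
        hence "ann (a [^] k \<otimes> c) = ann c"
          using max False ac c(1) by auto
        moreover have "a \<in> ann (a [^] k \<otimes> c)"
          unfolding ann_def using Suc.prems ac c(1) by (simp add: m_ac)
        ultimately show ?thesis
          unfolding ann_def using ac c(1) by (auto simp: m_comm)
      qed (use Suc.IH in blast)
    qed
  qed
  thus ?thesis using that c by blast
qed

text \<open>This is the descending chain condition in the localization at \<open>P\<close> modulo \<open>B\<close>, which is
  Artinian because \<open>P\<close> is nilpotent in it.\<close>

lemma saturated_descending_chain:
  assumes P: "primeideal P R" and B: "saturated P B"
    and rad: "\<And>a. a \<in> P \<Longrightarrow> \<exists>k::nat. \<exists>s\<in>carrier R - P. s \<otimes> a [^] k \<in> B"
    and A: "\<And>n. saturated P (A n)" "\<And>n. A (Suc n) \<subseteq> A n" "\<And>n. B \<subseteq> A n"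
  shows "\<exists>n. A (Suc n) = A n"
proof (rule ccontr)
  assume contr: "\<not> ?thesis"
  define rad where "rad B \<longleftrightarrow> (\<forall>a\<in>P. \<exists>k::nat. \<exists>s\<in>carrier R - P. s \<otimes> a [^] k \<in> B)" for B
  define bad where "bad B A \<longleftrightarrow> (\<forall>n::nat. saturated P (A n) \<and> A (Suc n) \<subset> A n \<and> B \<subseteq> A n)" for A B
  \<comment> \<open>Noetherian induction on the base ideal: \<open>B\<close> is taken maximal among
    those above which an infinite strictly descending chain exists.\<close>
  let ?F = "{B. saturated P B \<and> rad B \<and> (\<exists>A. bad B A)}"
  have "B \<in> ?F" using assms contr unfolding bad_def rad_def by blast
  hence "?F \<noteq> {}" by blast
  moreover have "ideal D R" if "D \<in> ?F" for D using that saturatedD by blast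
  ultimately obtain B where "B \<in> ?F" and max: "\<And>D. \<lbrakk>D \<in> ?F; B \<subseteq> D\<rbrakk> \<Longrightarrow> D = B"
    using maximal_ideal_in[of ?F] by blast
  then obtain A where B: "saturated P B" "rad B" and A: "bad B A" by blast
  have Ac: "A n \<subseteq> carrier R" for n
    using ideal_subset[of "A n"] A saturatedD(1) unfolding bad_def by blast
  have "B \<noteq> carrier R" using A Ac[of 0] unfolding bad_def by blast
  then obtain c where c: "c \<in> carrier R" "c \<notin> B" "\<And>a. a \<in> P \<Longrightarrow> a \<otimes> c \<in> B"
    using saturated_socle[OF P B(1)] B(2) unfolding rad_def by blast
  \<comment> \<open>\<open>ext\<close> adjoins the socle element \<open>c\<close>. As
    \<open>c\<close> is not in \<open>B\<close>, the ideal \<open>ext B\<close> is strictly larger,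
    so by maximality no strictly descending chain lives above it.\<close>
  define ext where "ext D = saturation P (D <+>\<^bsub>R\<^esub> PIdl c)" for D
  have ext: "saturated P (ext D)" "D \<subseteq> ext D" "c \<in> ext D" if "ideal D R" for D
    unfolding ext_def
    using saturation_saturated[OF P] saturation_superset[OF P] ideal_add_cgenideal[OF that c(1)] by blast+
  have "ext B \<notin> ?F" using max[of "ext B"] ext[OF saturatedD(1)[OF B(1)]] c(2) by blast
  moreover have "saturated P (ext B)" using ext saturatedD(1)[OF B(1)] by blast
  moreover have "rad (ext B)" using B(2) ext(2)[OF saturatedD(1)[OF B(1)]] unfolding rad_def by blast
  ultimately have no_bad: "\<not> bad (ext B) A'" for A' by blast
  have Aid: "ideal (A n) R" for n using A saturatedD(1) unfolding bad_def by blast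
  show False
  proof (cases "\<forall>n. c \<in> A n")
    case True
    have "ext B \<subseteq> A n" for n
      unfolding ext_def using A True Aid[of n] unfolding bad_def
      by (intro saturation_minimal add_cgenideal_minimal) auto
    hence "bad (ext B) A" using A unfolding bad_def by blast
    thus False using no_bad by blast
  next
    case False
    then obtain m where m: "c \<notin> A m" by blast
    have anti: "A (n + m) \<subseteq> A m" for n
      using A unfolding bad_def by (induction n) auto
    \<comment> \<open>Dropping the first \<open>m\<close> members leaves a chain that avoids
      \<open>c\<close> throughout. Adjoining \<open>c\<close> to it gives a chain above
      \<open>ext B\<close>, which must repeat; the original chain is then shown to repeat at the
      same place.\<close>
    define A' where "A' n = ext (A (n + m))" for n
    have "saturated P (A' n)" "A' (Suc n) \<subseteq> A' n" "ext B \<subseteq> A' n" for n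
    proof -
      show "saturated P (A' n)" unfolding A'_def using ext Aid by blast
      have "A (Suc n + m) \<subseteq> A (n + m)" "B \<subseteq> A (n + m)"
        using A unfolding bad_def by auto
      thus "A' (Suc n) \<subseteq> A' n" "ext B \<subseteq> A' n"
        unfolding A'_def ext_def by (auto intro!: saturation_mono simp: set_add_def')
    qed
    then obtain n where n: "A' (Suc n) = A' n"
      using no_bad[of A'] unfolding bad_def by blast
    have "A (n + m) \<subseteq> A (Suc (n + m))"
    proof
      fix a assume a: "a \<in> A (n + m)"
      hence "a \<in> ext (A (Suc (n + m)))"
        using n ext(2)[OF Aid] unfolding A'_def by auto
      then obtain s b r where s: "s \<in> carrier R - P" and b: "b \<in> A (Suc (n + m))"
        and r: "r \<in> carrier R" and eq: "s \<otimes> a = b \<oplus> r \<otimes> c"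
        unfolding ext_def using mem_saturation_add_cgenideal[OF Aid c(1)] by blast
      have "b \<in> A (n + m)" using b A unfolding bad_def by blast
      moreover have "b \<oplus> r \<otimes> c \<in> A (n + m)"
        using ideal.I_l_closed[OF Aid a, of s] s unfolding eq by blast
      ultimately have "r \<otimes> c \<in> A (n + m)"
        using ideal_add_cancel[OF Aid _ m_closed[OF r c(1)]] by blast
      \<comment> \<open>An \<open>r\<close> outside \<open>P\<close> could be cancelled and would
        put \<open>c\<close> into \<open>A (n + m)\<close>. With \<open>r\<close> in
        \<open>P\<close>, the socle property puts \<open>r \<otimes> c\<close> into
        \<open>B\<close>, hence into the next member of the chain.\<close>
      hence "r \<in> P"
        using saturatedD(2)[of P "A (n + m)" r c] A r c(1) m anti[of n] unfolding bad_def by blast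
      hence "r \<otimes> c \<in> A (Suc (n + m))" using c(3) A unfolding bad_def by blast
      hence "s \<otimes> a \<in> A (Suc (n + m))" unfolding eq using b ideal_add_mem[OF Aid] by blast
      thus "a \<in> A (Suc (n + m))"
        using saturatedD(2)[of P "A (Suc (n + m))" s a] A s a Ac unfolding bad_def by blast
    qed
    thus False using A unfolding bad_def by blast
  qed
qed

text \<open>If \<open>N\<close> were larger than \<open>L\<close>, choose a saturated
  \<open>K\<close> maximal among those containing \<open>L\<close> and strictly inside
  \<open>N\<close>. Then \<open>N\<close> is generated by a single \<open>a\<close> modulo
  \<open>K\<close>, up to denominators, and the determinant of the usual argument is the one
  coefficient \<open>t \<otimes> s \<ominus> x \<otimes> u\<close>. It lies outside \<open>P\<close>
  because \<open>x\<close> is in \<open>P\<close>, so it can be cancelled.\<close>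

lemma saturated_nakayama:
  assumes P: "primeideal P R" and N: "saturated P N" and L: "saturated P L" "L \<subseteq> N"
    and x: "x \<in> P"
    and NL: "\<And>a. a \<in> N \<Longrightarrow> \<exists>s\<in>carrier R - P. \<exists>l\<in>L. \<exists>r\<in>N. s \<otimes> a = l \<oplus> x \<otimes> r"
  shows "N = L"
proof (rule ccontr)
  assume "N \<noteq> L"
  have Pid: "ideal P R" using primeideal.axioms(1)[OF P] .
  let ?F = "{K. saturated P K \<and> L \<subseteq> K \<and> K \<subset> N}"
  have "L \<in> ?F" using L \<open>N \<noteq> L\<close> by auto
  moreover have "ideal D R" if "D \<in> ?F" for D using that saturatedD by blast
  ultimately obtain K where "K \<in> ?F" and max: "\<And>D. \<lbrakk>D \<in> ?F; K \<subseteq> D\<rbrakk> \<Longrightarrow> D = K"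
    using maximal_ideal_in[of ?F] by blast
  then obtain a where K: "saturated P K" "L \<subseteq> K" "K \<subseteq> N" and a: "a \<in> N" "a \<notin> K" by blast
  note Kid = saturatedD(1)[OF K(1)]
  have Nc: "N \<subseteq> carrier R" using ideal_subset[OF saturatedD(1)[OF N]] .
  have Kc: "K \<subseteq> carrier R" using K(3) Nc by auto
  have xc: "x \<in> carrier R" using x ideal_subset[OF Pid] by blast
  have ac: "a \<in> carrier R" using a Nc by auto
  let ?K = "saturation P (K <+>\<^bsub>R\<^esub> PIdl a)"
  have sup: "saturated P ?K" "K \<subseteq> ?K" "a \<in> ?K"
    using saturation_saturated[OF P] saturation_superset[OF P] ideal_add_cgenideal[OF Kid ac] by blast+
  have "?K \<subseteq> N"
    using saturation_minimal[OF N add_cgenideal_minimal[OF saturatedD(1)[OF N] K(3) a(1)]] .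
  hence "?K = N" using max[of ?K] sup K(2) a(2) by blast
  obtain s l r where s: "s \<in> carrier R - P" and l: "l \<in> L" and r: "r \<in> N" and eq: "s \<otimes> a = l \<oplus> x \<otimes> r"
    using NL[OF a(1)] by blast
  have "r \<in> ?K" using r \<open>?K = N\<close> by simp
  then obtain t k u where t: "t \<in> carrier R - P" and k: "k \<in> K" and u: "u \<in> carrier R"
    and eq': "t \<otimes> r = k \<oplus> u \<otimes> a"
    using mem_saturation_add_cgenideal[OF Kid ac] by blast
  have lK: "l \<in> K" using l K(2) by auto
  have cs: "s \<in> carrier R" "t \<in> carrier R" "r \<in> carrier R" "l \<in> carrier R" "k \<in> carrier R"
    using s t r Nc lK Kc k by auto
  have "(t \<otimes> s) \<otimes> a = t \<otimes> l \<oplus> x \<otimes> (t \<otimes> r)"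
    using eq cs ac xc by (simp add: m_assoc r_distr m_lcomm)
  also have "\<dots> = (t \<otimes> l \<oplus> x \<otimes> k) \<oplus> (x \<otimes> u) \<otimes> a"
    using eq' cs ac xc u by (simp add: r_distr m_assoc a_assoc)
  finally have *: "(t \<otimes> s) \<otimes> a = (t \<otimes> l \<oplus> x \<otimes> k) \<oplus> (x \<otimes> u) \<otimes> a" .
  have "(t \<otimes> s \<ominus> x \<otimes> u) \<otimes> a = (t \<otimes> s) \<otimes> a \<ominus> (x \<otimes> u) \<otimes> a"
    using cs ac xc u by (simp add: a_minus_def l_distr l_minus)
  also have "\<dots> = t \<otimes> l \<oplus> x \<otimes> k"
    unfolding * using cs ac xc u by (simp add: a_minus_def a_assoc r_neg)
  also have "\<dots> \<in> K"
    using lK k cs xc by (auto intro!: ideal_add_mem[OF Kid] ideal.I_l_closed[OF Kid])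
  finally have mem: "(t \<otimes> s \<ominus> x \<otimes> u) \<otimes> a \<in> K" .
  have "t \<otimes> s \<ominus> x \<otimes> u \<notin> P"
  proof
    assume "t \<otimes> s \<ominus> x \<otimes> u \<in> P"
    moreover have "x \<otimes> u \<in> P" using ideal.I_r_closed[OF Pid x u] .
    ultimately have "(t \<otimes> s \<ominus> x \<otimes> u) \<oplus> x \<otimes> u \<in> P" using ideal_add_mem[OF Pid] by blast
    moreover have "(t \<otimes> s \<ominus> x \<otimes> u) \<oplus> x \<otimes> u = t \<otimes> s"
      using cs xc u by (simp add: a_minus_def a_assoc l_neg)
    ultimately show False using prime_compl_mult[OF P t s] by simp
  qed
  hence "a \<in> K" using saturatedD(2)[OF K(1) _ ac mem] cs xc u by auto
  thus False using a(2) by blast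
qed

end

section \<open>Krull dimension and regular parameters\<close>

context noetherian_cring
begin

lemma prime_subset_carrier: "primeideal P R \<Longrightarrow> P \<subseteq> carrier R"
  using ideal_subset primeideal.axioms(1) by blast

text \<open>A larger prime allows fewer denominators. This lets ideals saturated at \<open>Q\<close>
  be handled in the localization at \<open>P\<close>.\<close>

lemma saturated_antimono:
  assumes "saturated Q A" "Q \<subseteq> P"
  shows "saturated P A"
  using assms unfolding saturated_def by blast

text \<open>Krull's principal ideal theorem in the ring \<open>R/P0\<close>: a prime of height at least two is
  not minimal over \<open>x\<close>. The symbolic powers of \<open>(b)\<close> at \<open>Q\<close> become stationary modulo \<open>x\<close>, hence
  by Nakayama become stationary, which in a domain is impossible for \<open>b \<noteq> 0\<close>.\<close>

lemma not_minimal_over_element: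
  assumes P0: "primeideal P0 R" and Q: "primeideal Q R" and P: "primeideal P R"
    and sub: "P0 \<subset> Q" "Q \<subset> P" and x: "x \<in> P"
  shows "\<exists>a\<in>P. \<forall>k::nat. \<forall>s\<in>carrier R - P. s \<otimes> a [^] k \<notin> P0 <+>\<^bsub>R\<^esub> PIdl x"
proof (rule ccontr)
  assume "\<not> ?thesis"
  hence rad: "\<exists>k::nat. \<exists>s\<in>carrier R - P. s \<otimes> a [^] k \<in> P0 <+>\<^bsub>R\<^esub> PIdl x" if "a \<in> P" for a
    using that by blast
  have id: "ideal P0 R" "ideal Q R" "ideal P R"
    using P0 Q P primeideal.axioms(1) by blast+
  have Pc: "P \<subseteq> carrier R" using prime_subset_carrier[OF P] .
  have Qc: "Q \<subseteq> carrier R" using sub(2) Pc by blast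
  have P0c: "P0 \<subseteq> carrier R" using sub(1) Qc by blast
  have xc: "x \<in> carrier R" using x Pc by blast
  have xQ: "x \<notin> Q"
  proof
    assume "x \<in> Q"
    hence B: "P0 <+>\<^bsub>R\<^esub> PIdl x \<subseteq> Q" using add_cgenideal_minimal[OF id(2)] sub(1) by blast
    have "P \<subseteq> Q"
    proof
      fix a assume a: "a \<in> P"
      then obtain k :: nat and s where s: "s \<in> carrier R - P" "s \<otimes> a [^] k \<in> Q"
        using rad B by blast
      hence "a [^] k \<in> Q" using primeideal.I_prime[OF Q, of s "a [^] k"] a Pc sub(2) by auto
      thus "a \<in> Q" using prime_pow_mem[OF Q] a Pc by blast
    qed
    thus False using sub(2) by blast
  qed
  obtain b where b: "b \<in> Q" "b \<notin> P0" using sub(1) by blast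
  have bc: "b \<in> carrier R" using b Qc by blast
  \<comment> \<open>\<open>I n\<close> is the \<open>n\<close>-th symbolic power of \<open>b\<close>
    at \<open>Q\<close> modulo \<open>P0\<close>.\<close>
  define D where "D n = P0 <+>\<^bsub>R\<^esub> PIdl (b [^] n)" for n :: nat
  define I where "I n = saturation Q (D n)" for n
  have D: "ideal (D n) R" "P0 \<subseteq> D n" "b [^] n \<in> D n" for n
    unfolding D_def using ideal_add_cgenideal[OF id(1), of "b [^] n"] bc by auto
  have I_Q: "saturated Q (I n)" for n unfolding I_def using saturation_saturated[OF Q D(1)] .
  have I_P: "saturated P (I n)" for n using saturated_antimono[OF I_Q] sub(2) by blast
  have Iid: "ideal (I n) R" for n using saturatedD(1)[OF I_P] .
  have D_dec: "D (Suc n) \<subseteq> D n" for n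
  proof -
    have "b [^] Suc n \<in> D n" using ideal.I_r_closed[OF D(1) D(3) bc] by simp
    thus ?thesis unfolding D_def[of "Suc n"] using add_cgenideal_minimal[OF D(1) D(2)] by blast
  qed
  have I_dec: "I (Suc n) \<subseteq> I n" for n unfolding I_def using saturation_mono[OF D_dec] .
  have P0_I: "P0 \<subseteq> I n" for n
    unfolding I_def using saturation_superset[OF Q D(1)] D(2) by blast
  \<comment> \<open>These are the symbolic powers modulo \<open>x\<close>, seen at \<open>P\<close>.
    By \<open>rad\<close> the descending chain condition holds there.\<close>
  define A where "A n = saturation P (I n <+>\<^bsub>R\<^esub> PIdl x)" for n
  let ?B = "saturation P (P0 <+>\<^bsub>R\<^esub> PIdl x)"
  have "\<exists>n. A (Suc n) = A n"
  proof (rule saturated_descending_chain[OF P])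
    show "saturated P ?B"
      using saturation_saturated[OF P ideal_add_cgenideal(1)[OF id(1) xc]] .
    show "\<exists>k::nat. \<exists>s\<in>carrier R - P. s \<otimes> a [^] k \<in> ?B" if "a \<in> P" for a
      using rad[OF that] saturation_superset[OF P ideal_add_cgenideal(1)[OF id(1) xc]] by blast
    show "saturated P (A n)" for n
      unfolding A_def using saturation_saturated[OF P ideal_add_cgenideal(1)[OF Iid xc]] .
    show "A (Suc n) \<subseteq> A n" "?B \<subseteq> A n" for n
      unfolding A_def using I_dec[of n] P0_I[of n]
      by (auto intro!: saturation_mono simp: set_add_def')
  qed
  then obtain n where n: "A (Suc n) = A n" by blast
  have "I n = I (Suc n)"
  proof (rule saturated_nakayama[OF P I_P I_P I_dec x])
    fix a assume a: "a \<in> I n"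
    have "a \<in> A (Suc n)"
      unfolding n unfolding A_def
      using a saturation_superset[OF P] ideal_add_cgenideal[OF Iid xc] by blast
    then obtain s l r where s: "s \<in> carrier R - P" and l: "l \<in> I (Suc n)" and r: "r \<in> carrier R"
      and eq: "s \<otimes> a = l \<oplus> r \<otimes> x"
      unfolding A_def using mem_saturation_add_cgenideal[OF Iid xc] by blast
    have "l \<in> I n" using l I_dec by blast
    moreover have "l \<oplus> r \<otimes> x \<in> I n"
      using ideal.I_l_closed[OF Iid a, of s] s unfolding eq by blast
    ultimately have "r \<otimes> x \<in> I n" using ideal_add_cancel[OF Iid _ m_closed[OF r xc]] by blast
    hence "x \<otimes> r \<in> I n" using m_comm[OF r xc] by simp
    \<comment> \<open>Since \<open>x\<close> is outside \<open>Q\<close>, it is an admissible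
      denominator for the \<open>Q\<close>-saturated \<open>I n\<close> and cancels. The coefficient
      of \<open>x\<close> thus lies in \<open>I n\<close>, as Nakayama requires.\<close>
    hence "r \<in> I n" using saturatedD(2)[OF I_Q] xc xQ r by blast
    moreover have "s \<otimes> a = l \<oplus> x \<otimes> r" using eq m_comm[OF r xc] by simp
    ultimately show "\<exists>s\<in>carrier R - P. \<exists>l\<in>I (Suc n). \<exists>r\<in>I n. s \<otimes> a = l \<oplus> x \<otimes> r"
      using s l by blast
  qed
  moreover have "b [^] n \<in> I n"
    unfolding I_def using saturation_superset[OF Q D(1)] D(3) by blast
  ultimately have "b [^] n \<in> I (Suc n)" by simp
  then obtain s p r where s: "s \<in> carrier R - Q" and p: "p \<in> P0" and r: "r \<in> carrier R"
    and eq: "s \<otimes> b [^] n = p \<oplus> r \<otimes> b [^] Suc n"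
    unfolding I_def D_def using mem_saturation_add_cgenideal[OF id(1), of "b [^] Suc n"] bc by blast
  have sc: "s \<in> carrier R" "p \<in> carrier R" using s p P0c by auto
  have "(r \<otimes> b) \<otimes> b [^] n = r \<otimes> b [^] Suc n"
    using bc r by (simp add: m_ac)
  hence "(s \<ominus> r \<otimes> b) \<otimes> b [^] n = s \<otimes> b [^] n \<ominus> r \<otimes> b [^] Suc n"
    using sc bc r by (simp add: a_minus_def l_distr l_minus del: nat_pow_Suc)
  also have "\<dots> = p"
    unfolding eq using sc bc r by (simp add: a_minus_def a_assoc r_neg)
  finally have "(s \<ominus> r \<otimes> b) \<otimes> b [^] n \<in> P0" using p by simp
  \<comment> \<open>Both alternatives fail: \<open>b [^] n\<close> in \<open>P0\<close> would give
    \<open>b\<close> in \<open>P0\<close>, and \<open>s \<ominus> r \<otimes> b\<close> in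
    \<open>P0\<close> would put \<open>s\<close> into \<open>Q\<close>, as \<open>b\<close> is in
    \<open>Q\<close>.\<close>
  hence "s \<ominus> r \<otimes> b \<in> P0 \<or> b [^] n \<in> P0"
    using primeideal.I_prime[OF P0] sc r bc by auto
  hence "s \<ominus> r \<otimes> b \<in> Q" using prime_pow_mem[OF P0 bc] b(2) sub(1) by blast
  moreover have "r \<otimes> b \<in> Q" using ideal.I_l_closed[OF id(2) b(1) r] .
  ultimately have "(s \<ominus> r \<otimes> b) \<oplus> r \<otimes> b \<in> Q" using ideal_add_mem[OF id(2)] by blast
  moreover have "(s \<ominus> r \<otimes> b) \<oplus> r \<otimes> b = s"
    using sc r bc by (simp add: a_minus_def a_assoc l_neg)
  ultimately show False using s by simp
qed

text \<open>The middle prime of a chain can be exchanged for one through \<open>x\<close>. Some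
  \<open>a\<close> in \<open>P\<close> stays non-nilpotent modulo \<open>P0\<close> and
  \<open>x\<close> at \<open>P\<close>, and a prime over these two that avoids \<open>a\<close> lies
  strictly below \<open>P\<close>.\<close>

lemma exists_prime_between:
  assumes P0: "primeideal P0 R" and Q: "primeideal Q R" and P: "primeideal P R"
    and sub: "P0 \<subset> Q" "Q \<subset> P" and x: "x \<in> P"
  obtains Q' where "primeideal Q' R" "P0 \<subset> Q'" "Q' \<subset> P" "x \<in> Q'"
proof (cases "x \<in> P0")
  case True
  thus ?thesis using that Q sub by blast
next
  case False
  have xc: "x \<in> carrier R" using x prime_subset_carrier[OF P] by blast
  have B: "ideal (P0 <+>\<^bsub>R\<^esub> PIdl x) R" "P0 \<subseteq> P0 <+>\<^bsub>R\<^esub> PIdl x" "x \<in> P0 <+>\<^bsub>R\<^esub> PIdl x"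
    using ideal_add_cgenideal[OF primeideal.axioms(1)[OF P0] xc] by auto
  obtain a where a: "a \<in> P"
    and disj: "\<And>(k::nat) s. s \<in> carrier R - P \<Longrightarrow> s \<otimes> a [^] k \<notin> P0 <+>\<^bsub>R\<^esub> PIdl x"
    using not_minimal_over_element[OF assms] by blast
  have ac: "a \<in> carrier R" using a prime_subset_carrier[OF P] by blast
  \<comment> \<open>Missing \<open>S\<close> means two things for a prime: being contained in
    \<open>P\<close> (take \<open>k = 0\<close>) and not containing \<open>a\<close> (take
    \<open>s = \<one>\<close>, \<open>k = 1\<close>).\<close>
  define S where "S = {s \<otimes> a [^] k | s (k::nat). s \<in> carrier R - P}"
  have S: "s \<otimes> a [^] k \<in> S" if "s \<in> carrier R - P" for s and k :: nat
    unfolding S_def using that by blast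
  have one: "\<one> \<in> carrier R - P" using prime_compl_one[OF P] .
  obtain Q' where Q': "primeideal Q' R" "P0 <+>\<^bsub>R\<^esub> PIdl x \<subseteq> Q'" "Q' \<inter> S = {}"
  proof (rule exists_prime_disjoint[OF B(1)])
    show "S \<subseteq> carrier R" unfolding S_def using ac by auto
    show "S \<noteq> {}" using S[OF one] by blast
    show "(P0 <+>\<^bsub>R\<^esub> PIdl x) \<inter> S = {}" unfolding S_def using disj by blast
    fix u v assume "u \<in> S" "v \<in> S"
    then obtain s t and k l :: nat where *: "u = s \<otimes> a [^] k" "v = t \<otimes> a [^] l"
      "s \<in> carrier R - P" "t \<in> carrier R - P"
      unfolding S_def by blast
    hence "u \<otimes> v = (s \<otimes> t) \<otimes> a [^] (k + l)"
      using ac by (simp add: nat_pow_mult[symmetric] m_ac)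
    thus "u \<otimes> v \<in> S" using S prime_compl_mult[OF P] * by simp
  qed
  have "s \<in> P" if "s \<in> Q'" for s
  proof (rule ccontr)
    assume "s \<notin> P"
    moreover have "s \<in> carrier R" using that prime_subset_carrier[OF Q'(1)] by blast
    ultimately have "s \<in> S" using S[of s 0] by simp
    thus False using that Q'(3) by blast
  qed
  moreover have "a \<notin> Q'" using S[OF one, of 1] ac Q'(3) by auto
  ultimately have "Q' \<subset> P" using a by blast
  moreover have "P0 \<subset> Q'" "x \<in> Q'" using False B Q'(2) by blast+
  ultimately show ?thesis using that Q'(1) by blast
qed

section \<open>Chains of primes and Krull's height theorem\<close>

definition prime_chain :: "nat \<Rightarrow> (nat \<Rightarrow> 'a set) \<Rightarrow> bool" where
  "prime_chain n P \<longleftrightarrow> (\<forall>i\<le>n. primeideal (P i) R) \<and> (\<forall>i<n. P i \<subset> P (Suc i))"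

text \<open>Both ends stay fixed while \<open>x\<close> is pushed down from the top: each use of
  \<open>exists_prime_between\<close> exchanges the prime just below one that contains
  \<open>x\<close>.\<close>

lemma prime_chain_through:
  assumes "prime_chain (Suc n) P" "x \<in> P (Suc n)"
  shows "\<exists>P'. prime_chain (Suc n) P' \<and> P' 0 = P 0 \<and> P' (Suc n) = P (Suc n) \<and> x \<in> P' 1"
  using assms
proof (induction n arbitrary: P)
  case 0
  thus ?case by auto
next
  case (Suc n)
  note P = Suc.prems(1)[unfolded prime_chain_def]
  obtain Q where Q: "primeideal Q R" "P n \<subset> Q" "Q \<subset> P (Suc (Suc n))" "x \<in> Q"
    using exists_prime_between[of "P n" "P (Suc n)" "P (Suc (Suc n))" x] P Suc.prems(2) by auto
  \<comment> \<open>\<open>P1\<close> is used only up to index \<open>Suc n\<close>, with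
    \<open>Q\<close> as its top; the old top is put back in \<open>P2\<close>.\<close>
  define P1 where "P1 = P(Suc n := Q)"
  have "prime_chain (Suc n) P1" and P1: "x \<in> P1 (Suc n)" "P1 0 = P 0" "P1 (Suc n) = Q"
    unfolding prime_chain_def P1_def using P Q by auto
  then obtain P' where P': "prime_chain (Suc n) P'" "P' 0 = P 0" "P' (Suc n) = Q" "x \<in> P' 1"
    using Suc.IH[of P1] by auto
  define P2 where "P2 = P'(Suc (Suc n) := P (Suc (Suc n)))"
  have "prime_chain (Suc (Suc n)) P2"
    unfolding P2_def using P' P Q unfolding prime_chain_def by (auto simp: less_Suc_eq le_Suc_eq)
  moreover have "P2 0 = P 0" "P2 (Suc (Suc n)) = P (Suc (Suc n))" "x \<in> P2 1"
    unfolding P2_def using P' by auto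
  ultimately show ?case by blast
qed

text \<open>Krull's height theorem in contrapositive form.\<close>

lemma prime_below_generators:
  assumes "prime_chain n P" "set ys \<subseteq> P n" "length ys < n"
  shows "\<exists>Q. primeideal Q R \<and> P 0 \<subseteq> Q \<and> set ys \<subseteq> Q \<and> Q \<subset> P n"
  using assms
proof (induction ys arbitrary: n P)
  case Nil
  have "P 0 \<subseteq> P j" if "j \<le> n" for j
    using that
  proof (induction j)
    case (Suc j)
    moreover have "P j \<subset> P (Suc j)" using Suc.prems Nil.prems(1) unfolding prime_chain_def by auto
    ultimately show ?case by auto
  qed simp
  moreover obtain m where m: "n = Suc m" using Nil.prems(3) gr0_implies_Suc by auto
  ultimately have "P 0 \<subseteq> P m" by simp
  thus ?case using Nil.prems(1) unfolding prime_chain_def m by (intro exI[of _ "P m"]) auto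
next
  case (Cons y ys)
  obtain m where m: "n = Suc m" using Cons.prems(3) by (cases n) auto
  obtain P' where P': "prime_chain n P'" "P' 0 = P 0" "P' n = P n" "y \<in> P' 1"
    using prime_chain_through[of m P y] Cons.prems(1,2) m by auto
  \<comment> \<open>Dropping the lowest prime costs one step of the chain and pays for the generator
    \<open>y\<close>, which already lies in the new lowest prime and hence in every prime above
    it.\<close>
  have "prime_chain m (\<lambda>i. P' (Suc i))"
    using P'(1) unfolding prime_chain_def m by auto
  moreover have "set ys \<subseteq> P' (Suc m)" "length ys < m" using Cons.prems(2,3) P'(3) m by auto
  ultimately obtain Q where Q: "primeideal Q R" "P' 1 \<subseteq> Q" "set ys \<subseteq> Q" "Q \<subset> P' (Suc m)"
    using Cons.IH[where n = m and P = "\<lambda>i. P' (Suc i)"] by auto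
  have "P' 0 \<subset> P' 1" using P'(1) unfolding prime_chain_def m by auto
  hence "P 0 \<subseteq> Q" "set (y # ys) \<subseteq> Q" "Q \<subset> P n" using P'(2,3,4) Q m by auto
  thus ?case using Q(1) by blast
qed

text \<open>A finite supremum in \<open>enat\<close> of a nonempty set is attained. The condition
  \<open>n > 0\<close> excludes the empty set, whose supremum is 0.\<close>

lemma exists_prime_chain:
  assumes "krull_dim R = enat n" "n > 0"
  obtains P where "prime_chain n P"
proof -
  define A where "A = {enat n | n. \<exists>P. prime_chain n P}"
  have Sup: "Sup A = enat n"
    using assms(1) unfolding krull_dim_def A_def prime_chain_def .
  have "A \<noteq> {}" using Sup assms(2) unfolding Sup_enat_def by (auto simp: zero_enat_def)
  moreover from this have "finite A" using Sup unfolding Sup_enat_def by (auto split: if_splits)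
  ultimately have "enat n \<in> A" using Sup Max_in[of A] unfolding Sup_enat_def by auto
  thus ?thesis using that unfolding A_def by auto
qed

lemma max_ideal_maximal:
  assumes "local_ring R"
  shows "maximalideal (max_ideal R) R"
  using assms theI'[of "\<lambda>M. maximalideal M R"] unfolding local_ring_def max_ideal_def by blast

lemma proper_ideal_subset_max_ideal:
  assumes "local_ring R" "ideal A R" "A \<noteq> carrier R"
  shows "A \<subseteq> max_ideal R"
proof -
  let ?F = "{B. ideal B R \<and> A \<subseteq> B \<and> B \<noteq> carrier R}"
  have "?F \<noteq> {}" using assms(2,3) by blast
  then obtain M where "M \<in> ?F" and max: "\<And>B. \<lbrakk>B \<in> ?F; M \<subseteq> B\<rbrakk> \<Longrightarrow> B = M"
    using maximal_ideal_in[of ?F] by blast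
  hence M: "ideal M R" "A \<subseteq> M" "M \<noteq> carrier R" by auto
  have "maximalideal M R"
  proof (rule maximalidealI[OF M(1)])
    show "carrier R \<noteq> M" using M(3) by blast
    show "B = M \<or> B = carrier R" if "ideal B R" "M \<subseteq> B" for B
      using max[of B] that M(2) by blast
  qed
  hence "M = max_ideal R"
    using max_ideal_maximal[OF assms(1)] assms(1) unfolding local_ring_def by blast
  thus ?thesis using M(2) by simp
qed

end

text \<open>Only the degree is recorded, not the exponents: it is all that survives once every
  parameter is specialised to the same \<open>z\<close>.\<close>

primrec monomials :: "('a, 'b) ring_scheme \<Rightarrow> 'a set \<Rightarrow> nat \<Rightarrow> 'a set" where
  "monomials R S 0 = {\<one>\<^bsub>R\<^esub>}"
| "monomials R S (Suc d) = {u \<otimes>\<^bsub>R\<^esub> x | u x. u \<in> monomials R S d \<and> x \<in> S}"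

lemma (in cring) monomials_closed:
  assumes "S \<subseteq> carrier R"
  shows "monomials R S d \<subseteq> carrier R"
  using assms by (induction d) auto

lemma (in cring) monomials_mult:
  assumes S: "S \<subseteq> carrier R" and "u \<in> monomials R S d" "v \<in> monomials R S e"
  shows "u \<otimes> v \<in> monomials R S (d + e)"
  using assms(3)
proof (induction e arbitrary: v)
  case 0
  have "u \<in> carrier R" using monomials_closed[OF S] assms(2) by blast
  thus ?case using 0 assms(2) by simp
next
  case (Suc e)
  then obtain w x where w: "w \<in> monomials R S e" "x \<in> S" "v = w \<otimes> x" by auto
  have "u \<otimes> v = (u \<otimes> w) \<otimes> x"
    using w S monomials_closed[OF S] assms(2) by (auto simp: m_assoc subset_iff)
  thus ?case using Suc.IH[OF w(1)] w(2) by auto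
qed

lemma (in cring) monomials_pow:
  assumes S: "S \<subseteq> carrier R" and x: "x \<in> S"
  shows "x [^] (a::nat) \<in> monomials R S a"
  using x by (induction a) auto

lemma (in cring) ideal_pow_Suc:
  "I [^]\<^bsub>ideals_set R\<^esub> Suc n = (I [^]\<^bsub>ideals_set R\<^esub> n) \<cdot> I"
  by (simp add: nat_pow_def ideals_set_def)

lemma (in cring) ideal_pow_0: "I [^]\<^bsub>ideals_set R\<^esub> (0::nat) = carrier R"
  by (simp add: nat_pow_def ideals_set_def)

text \<open>Modulo \<open>K\<close> the ideal \<open>I\<close> sits inside the principal ideal of
  \<open>z\<close>. When \<open>k \<oplus> r \<otimes> z [^] n\<close> is multiplied by
  \<open>k' \<oplus> r' \<otimes> z\<close>, every term but the last has a factor in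
  \<open>K\<close>.\<close>

lemma (in cring) ideal_pow_subset:
  assumes K: "ideal K R" and z: "z \<in> carrier R" and I: "I \<subseteq> K <+>\<^bsub>R\<^esub> PIdl z"
  shows "I [^]\<^bsub>ideals_set R\<^esub> (n::nat) \<subseteq> K <+>\<^bsub>R\<^esub> PIdl (z [^] n)"
proof (induction n)
  case 0
  have "ideal (K <+>\<^bsub>R\<^esub> PIdl \<one>) R" "\<one> \<in> K <+>\<^bsub>R\<^esub> PIdl \<one>"
    using ideal_add_cgenideal[OF K, of \<one>] by auto
  thus ?case using ideal.one_imp_carrier[of _ R] unfolding ideal_pow_0 by simp
next
  case (Suc n)
  have Kc: "K \<subseteq> carrier R" using ideal_subset[OF K] .
  let ?J = "K <+>\<^bsub>R\<^esub> PIdl (z [^] Suc n)"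
  have J: "ideal ?J R" using ideal_add_cgenideal[OF K] z by simp
  have "s \<in> ?J" if "s \<in> (I [^]\<^bsub>ideals_set R\<^esub> n) \<cdot> I" for s
    using that
  proof (induction s rule: ideal_prod.induct)
    case (prod u v)
    obtain k r where k: "k \<in> K" "r \<in> carrier R" "u = k \<oplus> r \<otimes> z [^] n"
      using prod(1) Suc mem_add_cgenideal[OF Kc, of "z [^] n"] z by blast
    obtain k' r' where k': "k' \<in> K" "r' \<in> carrier R" "v = k' \<oplus> r' \<otimes> z"
      using prod(2) I mem_add_cgenideal[OF Kc z] by blast
    have kc: "k \<in> carrier R" "k' \<in> carrier R" using k k' Kc by auto
    have "u \<otimes> v = (v \<otimes> k \<oplus> (r \<otimes> z [^] n) \<otimes> k') \<oplus> (r \<otimes> r') \<otimes> z [^] Suc n"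
      using k k' kc z by (simp add: l_distr r_distr m_ac a_ac)
    moreover have "v \<otimes> k \<oplus> (r \<otimes> z [^] n) \<otimes> k' \<in> K"
      using k k' kc z by (intro ideal_add_mem[OF K] ideal.I_l_closed[OF K]) auto
    ultimately show ?case
      using mem_add_cgenideal[OF Kc, of "z [^] Suc n"] z k k' by blast
  next
    case (sum s t)
    thus ?case using ideal_add_mem[OF J] by blast
  qed
  thus ?case unfolding ideal_pow_Suc by blast
qed

text \<open>Modulo the differences of the parameters all parameters agree, so a monomial of degree \<open>d\<close>
  becomes \<open>z\<^sup>d\<close>. Were it in the next power of the maximal ideal, then this ideal would be minimal
  over the differences, of which there are fewer than the dimension.\<close>

theorem monomial_notin_ideal_pow:
  fixes R (structure)
  assumes reg: "regular_parameters R xs" and u: "u \<in> monomials R (set xs) d" and n: "d < n"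
  shows "u \<notin> max_ideal R [^]\<^bsub>ideals_set R\<^esub> n"
proof
  assume u_pow: "u \<in> max_ideal R [^]\<^bsub>ideals_set R\<^esub> n"
  have loc: "local_ring R" and "noetherian_ring R" and xs: "set xs \<subseteq> carrier R"
    and gen: "max_ideal R = Idl (set xs)" and dim: "krull_dim R = enat (length xs)"
    using reg unfolding regular_parameters_def by auto
  then interpret noetherian_cring R
    unfolding noetherian_cring_def local_ring_def by blast
  let ?m = "max_ideal R"
  have m_prime: "primeideal ?m R" using maximalideal_prime[OF max_ideal_maximal[OF loc]] .
  have m: "ideal ?m R" using primeideal.axioms(1)[OF m_prime] .
  show False
  proof (cases xs)
    \<comment> \<open>With no parameters there is no \<open>z\<close> to subtract. Then
      \<open>d = 0\<close> and \<open>u = \<one>\<close>, while a positive power of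
      \<open>?m\<close> stays inside \<open>?m\<close>.\<close>
    case Nil
    hence "u = \<one>" using u by (cases d) auto
    moreover have "?m [^]\<^bsub>ideals_set R\<^esub> n \<subseteq> ?m"
    proof -
      obtain k where k: "n = Suc k" using n by (cases n) auto
      have "?m \<subseteq> ?m <+>\<^bsub>R\<^esub> PIdl \<zero>" using ideal_add_cgenideal(2)[OF m] by simp
      hence "?m [^]\<^bsub>ideals_set R\<^esub> n \<subseteq> ?m <+>\<^bsub>R\<^esub> PIdl (\<zero> [^] n)"
        using ideal_pow_subset[OF m] by blast
      also have "\<dots> \<subseteq> ?m"
        using add_cgenideal_minimal[OF m order_refl, of "\<zero> [^] n"] ideal_zero_mem[OF m] k by simp
      finally show ?thesis .
    qed
    ultimately show False using u_pow prime_compl_one[OF m_prime] by blast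
  next
    case (Cons z zs)
    define ys where "ys = map (\<lambda>x. x \<ominus> z) zs"
    define K where "K = Idl (set ys)"
    have z: "z \<in> carrier R" "z \<in> ?m" and xs_m: "set xs \<subseteq> ?m"
      using xs genideal_self[OF xs] gen Cons by auto
    have ys_m: "set ys \<subseteq> ?m" using xs_m ideal_minus_mem[OF m] by (auto simp: ys_def Cons)
    hence ys: "set ys \<subseteq> carrier R" using ideal_subset[OF m] by blast
    have K: "ideal K R" "set ys \<subseteq> K" unfolding K_def using genideal_ideal[OF ys] genideal_self[OF ys] by auto
    have Kc: "K \<subseteq> carrier R" using ideal_subset[OF K(1)] .
    have x_K: "\<exists>k\<in>K. x = k \<oplus> z" if "x \<in> set xs" for x
    proof (cases "x = z")
      case True
      thus ?thesis using ideal_zero_mem[OF K(1)] z by (auto intro!: bexI[of _ "\<zero>"])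
    next
      case False
      hence "x \<ominus> z \<in> K" using that K(2) by (auto simp: ys_def Cons)
      moreover have "x = (x \<ominus> z) \<oplus> z"
        using that xs z by (auto simp: a_minus_def a_assoc l_neg)
      ultimately show ?thesis by blast
    qed
    have "\<exists>k\<in>K. u = k \<oplus> z [^] d"
      using u
    proof (induction d arbitrary: u)
      case 0
      thus ?case using ideal_zero_mem[OF K(1)] by (auto intro!: bexI[of _ "\<zero>"])
    next
      case (Suc d)
      then obtain v x where v: "v \<in> monomials R (set xs) d" "x \<in> set xs" "u = v \<otimes> x" by auto
      obtain k k' where k: "k \<in> K" "v = k \<oplus> z [^] d" "k' \<in> K" "x = k' \<oplus> z"
        using Suc.IH[OF v(1)] x_K[OF v(2)] by blast
      have kc: "k \<in> carrier R" "k' \<in> carrier R" using k Kc by auto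
      have "u = (x \<otimes> k \<oplus> z [^] d \<otimes> k') \<oplus> z [^] Suc d"
        unfolding v(3) k(2,4) using kc z by (simp add: l_distr r_distr m_ac a_ac)
      moreover have "x \<otimes> k \<oplus> z [^] d \<otimes> k' \<in> K"
        using k(1,3) v(2) xs z by (intro ideal_add_mem[OF K(1)] ideal.I_l_closed[OF K(1)]) auto
      ultimately show ?case by blast
    qed
    then obtain k where k: "k \<in> K" "u = k \<oplus> z [^] d" by blast
    have m_K: "?m \<subseteq> K <+>\<^bsub>R\<^esub> PIdl z"
      unfolding gen
    proof (rule genideal_minimal)
      show "ideal (K <+>\<^bsub>R\<^esub> PIdl z) R" using ideal_add_cgenideal[OF K(1) z(1)] by blast
      show "set xs \<subseteq> K <+>\<^bsub>R\<^esub> PIdl z"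
      proof
        fix x assume "x \<in> set xs"
        then obtain k where "k \<in> K" "x = k \<oplus> \<one> \<otimes> z" using x_K z by auto
        thus "x \<in> K <+>\<^bsub>R\<^esub> PIdl z" using mem_add_cgenideal[OF Kc z(1)] by blast
      qed
    qed
    obtain k' r where k': "k' \<in> K" "r \<in> carrier R" "u = k' \<oplus> r \<otimes> z [^] n"
      using ideal_pow_subset[OF K(1) z(1) m_K] u_pow mem_add_cgenideal[OF Kc, of "z [^] n"] z(1) by blast
    \<comment> \<open>As \<open>d < n\<close>, a factor \<open>z\<close> is left over beyond
      \<open>z [^] e\<close> and \<open>z [^] d\<close>. It places \<open>w \<otimes> z\<close> in
      \<open>?m\<close> and so makes \<open>\<one> \<ominus> w \<otimes> z\<close> a unit.\<close>
    obtain e where e: "n = Suc e + d" using n less_iff_Suc_add by (metis add.commute add_Suc_right)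
    define w where "w = r \<otimes> z [^] e"
    have w: "w \<in> carrier R" unfolding w_def using k' z by simp
    have kc: "k \<in> carrier R" "k' \<in> carrier R" using k k' Kc by auto
    have "u = k' \<oplus> (w \<otimes> z) \<otimes> z [^] d"
      unfolding k'(3) w_def e using k'(2) z by (simp add: nat_pow_mult[symmetric] m_ac)
    hence eq: "k \<oplus> z [^] d = k' \<oplus> (w \<otimes> z) \<otimes> z [^] d" using k(2) by simp
    have "k \<oplus> (\<one> \<ominus> w \<otimes> z) \<otimes> z [^] d = (k \<oplus> z [^] d) \<ominus> (w \<otimes> z) \<otimes> z [^] d"
      using kc w z by (simp add: a_minus_def l_distr l_minus a_assoc)
    also have "\<dots> = k'"
      unfolding eq using kc w z by (simp add: a_minus_def a_assoc r_neg)
    finally have in_K: "(\<one> \<ominus> w \<otimes> z) \<otimes> z [^] d \<in> K"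
      using ideal_add_cancel[OF K(1) k(1)] k'(1) w z by auto
    obtain P where P: "prime_chain (length xs) P"
      using exists_prime_chain[OF dim] Cons by auto
    have "P (length xs) \<subseteq> ?m"
    proof -
      have "primeideal (P (length xs)) R" using P unfolding prime_chain_def by blast
      thus ?thesis
        using proper_ideal_subset_max_ideal[OF loc] primeideal.axioms(1) primeideal.I_notcarr by metis
    qed
    \<comment> \<open>The top of a longest chain is only known to lie inside \<open>?m\<close>.
      Replacing it by \<open>?m\<close> keeps the inclusions strict.\<close>
    define P' where "P' = P(length xs := ?m)"
    have "prime_chain (length xs) P'"
      using P m_prime \<open>P (length xs) \<subseteq> ?m\<close> unfolding prime_chain_def P'_def by (auto simp: Cons)
    moreover have "P' (length xs) = ?m" unfolding P'_def by simp
    moreover have "length ys < length xs" unfolding ys_def Cons by simp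
    ultimately obtain Q where Q: "primeideal Q R" "set ys \<subseteq> Q" "Q \<subset> ?m"
      using prime_below_generators[of "length xs" P' ys] ys_m by auto
    have Qid: "ideal Q R" using primeideal.axioms(1)[OF Q(1)] .
    have KQ: "K \<subseteq> Q" unfolding K_def using genideal_minimal[OF Qid Q(2)] .
    have "\<one> \<ominus> w \<otimes> z \<notin> ?m"
    proof
      assume "\<one> \<ominus> w \<otimes> z \<in> ?m"
      moreover have "w \<otimes> z \<in> ?m" using ideal.I_l_closed[OF m z(2) w] .
      ultimately have "(\<one> \<ominus> w \<otimes> z) \<oplus> w \<otimes> z \<in> ?m" using ideal_add_mem[OF m] by blast
      moreover have "(\<one> \<ominus> w \<otimes> z) \<oplus> w \<otimes> z = \<one>"
        using w z by (simp add: a_minus_def a_assoc l_neg)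
      ultimately show False using prime_compl_one[OF m_prime] by simp
    qed
    hence "z [^] d \<in> Q"
      using primeideal.I_prime[OF Q(1), of "\<one> \<ominus> w \<otimes> z" "z [^] d"] in_K KQ Q(3) w z by auto
    \<comment> \<open>With \<open>z\<close> and the differences in \<open>Q\<close>, all parameters
      are, so \<open>?m\<close> falls into its proper subset \<open>Q\<close>.\<close>
    hence "z \<in> Q" using prime_pow_mem[OF Q(1) z(1)] by blast
    hence "K <+>\<^bsub>R\<^esub> PIdl z \<subseteq> Q" using add_cgenideal_minimal[OF Qid KQ] by blast
    thus False using m_K Q(3) by blast
  qed
qed

section \<open>The semiring of ideals\<close>

context cring
begin

lemma ideals_set_carrier [simp]: "carrier (ideals_set R) = {I. ideal I R}"
  by (simp add: ideals_set_def)

lemma ideals_set_mult [simp]: "I \<otimes>\<^bsub>ideals_set R\<^esub> J = I \<cdot> J"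
  by (simp add: ideals_set_def)

lemma ideals_set_one [simp]: "\<one>\<^bsub>ideals_set R\<^esub> = carrier R"
  by (simp add: ideals_set_def)

lemma ideal_pow_ideal:
  assumes "ideal I R"
  shows "ideal (I [^]\<^bsub>ideals_set R\<^esub> (n::nat)) R"
proof -
  interpret M: comm_monoid "ideals_set R" by (rule ideals_set_is_comm_monoid)
  show ?thesis using M.nat_pow_closed[of I n] assms by simp
qed

lemma ideal_finprod_ideal:
  assumes "\<And>i. i \<in> S \<Longrightarrow> ideal (A i) R"
  shows "ideal (\<Otimes>\<^bsub>ideals_set R\<^esub>i\<in>S. A i) R"
proof -
  interpret M: comm_monoid "ideals_set R" by (rule ideals_set_is_comm_monoid)
  show ?thesis using M.finprod_closed[of A S] assms by auto
qed

lemma ideal_finprod_insert: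
  assumes "finite S" "i \<notin> S" "\<And>j. j \<in> insert i S \<Longrightarrow> ideal (A j) R"
  shows "(\<Otimes>\<^bsub>ideals_set R\<^esub>j\<in>insert i S. A j) = A i \<cdot> (\<Otimes>\<^bsub>ideals_set R\<^esub>j\<in>S. A j)"
proof -
  interpret M: comm_monoid "ideals_set R" by (rule ideals_set_is_comm_monoid)
  show ?thesis using M.finprod_insert[of S i A] assms by auto
qed

lemma ideal_finprod_empty: "(\<Otimes>\<^bsub>ideals_set R\<^esub>i\<in>{}. A i) = carrier R"
proof -
  interpret M: comm_monoid "ideals_set R" by (rule ideals_set_is_comm_monoid)
  show ?thesis by simp
qed

lemma ideal_prod_mono:
  assumes "I \<subseteq> I'" "J \<subseteq> J'"
  shows "I \<cdot> J \<subseteq> I' \<cdot> J'"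
proof
  fix s assume "s \<in> I \<cdot> J"
  thus "s \<in> I' \<cdot> J'"
    by (induction s rule: ideal_prod.induct) (use assms in \<open>auto intro: ideal_prod.intros\<close>)
qed

lemma ideal_pow_mono:
  assumes "I \<subseteq> J"
  shows "I [^]\<^bsub>ideals_set R\<^esub> (n::nat) \<subseteq> J [^]\<^bsub>ideals_set R\<^esub> n"
proof (induction n)
  case 0
  show ?case unfolding ideal_pow_0 ..
next
  case (Suc n)
  show ?case unfolding ideal_pow_Suc using ideal_prod_mono[OF Suc assms] .
qed

lemma ideal_pow_add:
  assumes "ideal I R"
  shows "(I [^]\<^bsub>ideals_set R\<^esub> (n::nat)) \<cdot> (I [^]\<^bsub>ideals_set R\<^esub> (k::nat)) = I [^]\<^bsub>ideals_set R\<^esub> (n + k)"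
proof -
  interpret M: comm_monoid "ideals_set R" by (rule ideals_set_is_comm_monoid)
  show ?thesis using M.nat_pow_mult[of I n k] assms by simp
qed

text \<open>The higher power is a product with the lower one, and a product lies in the intersection
  of its factors.\<close>

lemma ideal_pow_antimono:
  assumes "ideal I R" "n \<le> k"
  shows "I [^]\<^bsub>ideals_set R\<^esub> (k::nat) \<subseteq> I [^]\<^bsub>ideals_set R\<^esub> (n::nat)"
  using ideal_pow_add[OF assms(1), of n "k - n"] assms(2)
    ideal_prod_inter[OF ideal_pow_ideal[OF assms(1), of n] ideal_pow_ideal[OF assms(1), of "k - n"]]
  by auto

lemma ideal_pow_mem:
  assumes "t \<in> I"
  shows "t [^] (n::nat) \<in> I [^]\<^bsub>ideals_set R\<^esub> n"
proof (induction n)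
  case 0
  show ?case unfolding ideal_pow_0 by simp
next
  case (Suc n)
  show ?case unfolding ideal_pow_Suc using ideal_prod.prod[OF Suc assms] by simp
qed

lemma ideal_finprod_subset_pow:
  assumes "finite S" "ideal I R" "\<And>i. i \<in> S \<Longrightarrow> ideal (A i) R"
    and "\<And>i. i \<in> S \<Longrightarrow> A i \<subseteq> I [^]\<^bsub>ideals_set R\<^esub> (d i :: nat)"
  shows "(\<Otimes>\<^bsub>ideals_set R\<^esub>i\<in>S. A i) \<subseteq> I [^]\<^bsub>ideals_set R\<^esub> (\<Sum>i\<in>S. d i)"
  using assms(1,3,4)
proof (induction S rule: finite_induct)
  case empty
  have "sum d {} = 0" by simp
  show ?case unfolding ideal_finprod_empty \<open>sum d {} = 0\<close> ideal_pow_0 ..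
next
  case (insert i S)
  have "A i \<cdot> (\<Otimes>\<^bsub>ideals_set R\<^esub>j\<in>S. A j) \<subseteq>
    (I [^]\<^bsub>ideals_set R\<^esub> d i) \<cdot> (I [^]\<^bsub>ideals_set R\<^esub> (\<Sum>j\<in>S. d j))"
    using insert by (intro ideal_prod_mono) auto
  moreover have "d i + (\<Sum>j\<in>S. d j) = (\<Sum>j\<in>insert i S. d j)" using insert(1,2) by simp
  ultimately show ?case
    using ideal_finprod_insert[OF insert(1,2), of A] insert.prems(1) ideal_pow_add[OF assms(2)]
    by auto
qed

lemma ideal_finsum_insert:
  assumes "finite S" "i \<notin> S" "\<And>j. j \<in> insert i S \<Longrightarrow> ideal (A j) R"
  shows "(\<Oplus>\<^bsub>ideals_set R\<^esub>j\<in>insert i S. A j) = A i <+>\<^bsub>R\<^esub> (\<Oplus>\<^bsub>ideals_set R\<^esub>j\<in>S. A j)"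
proof -
  interpret M: semiring "ideals_set R" by (rule ideals_set_is_semiring)
  have "(\<Oplus>\<^bsub>ideals_set R\<^esub>j\<in>insert i S. A j) = A i \<oplus>\<^bsub>ideals_set R\<^esub> (\<Oplus>\<^bsub>ideals_set R\<^esub>j\<in>S. A j)"
    using M.finsum_insert[of S i A] assms by auto
  thus ?thesis by (simp add: ideals_set_def)
qed

lemma ideal_finsum_ideal:
  assumes "\<And>i. i \<in> S \<Longrightarrow> ideal (A i) R"
  shows "ideal (\<Oplus>\<^bsub>ideals_set R\<^esub>i\<in>S. A i) R"
proof -
  interpret M: semiring "ideals_set R" by (rule ideals_set_is_semiring)
  show ?thesis using M.finsum_closed[of A S] assms by auto
qed

lemma ideal_finsum_empty: "(\<Oplus>\<^bsub>ideals_set R\<^esub>i\<in>{}. A i) = {\<zero>}"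
proof -
  interpret M: semiring "ideals_set R" by (rule ideals_set_is_semiring)
  show ?thesis using M.finsum_empty[of A] by (simp add: ideals_set_def)
qed

lemma ideal_finsum_minimal:
  assumes "finite S" "\<And>i. i \<in> S \<Longrightarrow> ideal (A i) R" "ideal B R" "\<And>i. i \<in> S \<Longrightarrow> A i \<subseteq> B"
  shows "(\<Oplus>\<^bsub>ideals_set R\<^esub>i\<in>S. A i) \<subseteq> B"
  using assms(1,2,4)
proof (induction S rule: finite_induct)
  case empty
  show ?case unfolding ideal_finsum_empty using ideal_zero_mem[OF assms(3)] by simp
next
  case (insert i S)
  have "A i \<subseteq> B" "(\<Oplus>\<^bsub>ideals_set R\<^esub>j\<in>S. A j) \<subseteq> B" using insert by auto
  hence "A i <+>\<^bsub>R\<^esub> (\<Oplus>\<^bsub>ideals_set R\<^esub>j\<in>S. A j) \<subseteq> B"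
    using ideal_add_mem[OF assms(3)] unfolding set_add_def' by blast
  thus ?case using ideal_finsum_insert[OF insert(1,2), of A] insert.prems(1) by simp
qed

lemma ideal_finsum_superset:
  assumes "finite S" "\<And>i. i \<in> S \<Longrightarrow> ideal (A i) R" "i \<in> S"
  shows "A i \<subseteq> (\<Oplus>\<^bsub>ideals_set R\<^esub>j\<in>S. A j)"
proof -
  let ?B = "\<Oplus>\<^bsub>ideals_set R\<^esub>j\<in>S - {i}. A j"
  have "S = insert i (S - {i})" using assms(3) by auto
  hence eq: "(\<Oplus>\<^bsub>ideals_set R\<^esub>j\<in>S. A j) = A i <+>\<^bsub>R\<^esub> ?B"
    using ideal_finsum_insert[of "S - {i}" i A] assms by simp
  have "\<zero> \<in> ?B" using ideal_zero_mem[OF ideal_finsum_ideal[of "S - {i}" A]] assms(2) by blast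
  show ?thesis
  proof
    fix s assume s: "s \<in> A i"
    hence "s = s \<oplus> \<zero>" using ideal.Icarr[OF assms(2)[OF assms(3)]] by simp
    thus "s \<in> (\<Oplus>\<^bsub>ideals_set R\<^esub>j\<in>S. A j)"
      unfolding eq set_add_def' using s \<open>\<zero> \<in> ?B\<close> by blast
  qed
qed

end

section \<open>Germs and stalks\<close>

context ringed_space
begin

lemma res_closed:
  "\<lbrakk>openin (topo X) U; openin (topo X) V; V \<subseteq> U; s \<in> carrier (sec X U)\<rbrakk>
    \<Longrightarrow> res X U V s \<in> carrier (sec X V)"
  using ring_hom_closed[OF res_hom] by blast

lemma germ_self:
  "\<lbrakk>openin (topo X) U; x \<in> U; s \<in> carrier (sec X U)\<rbrakk> \<Longrightarrow> (U, s) \<in> germ X x U s"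
  unfolding germ_def by auto

lemma germ_subset:
  assumes U: "openin (topo X) U" "s \<in> carrier (sec X U)"
    and V: "openin (topo X) V" "t \<in> carrier (sec X V)"
    and W: "openin (topo X) W" "x \<in> W" "W \<subseteq> U \<inter> V" "res X U W s = res X V W t"
  shows "germ X x U s \<subseteq> germ X x V t"
proof
  fix g assume "g \<in> germ X x U s"
  then obtain V' t' W' where g: "g = (V', t')" and V': "openin (topo X) V'" "x \<in> V'" "t' \<in> carrier (sec X V')"
    and W': "openin (topo X) W'" "x \<in> W'" "W' \<subseteq> U \<inter> V'" "res X U W' s = res X V' W' t'"
    unfolding germ_def by auto
  let ?W = "W \<inter> W'"
  have o: "openin (topo X) ?W" using W(1) W'(1) by blast
  have "res X V ?W t = res X W ?W (res X V W t)" using res_comp[of V W ?W t] V W o by auto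
  also have "\<dots> = res X U ?W s" using res_comp[of U W ?W s] U W o by auto
  also have "\<dots> = res X W' ?W (res X U W' s)" using res_comp[of U W' ?W s] U W' o by auto
  also have "\<dots> = res X V' ?W t'" using res_comp[of V' W' ?W t'] V' W' o by auto
  finally have "res X V ?W t = res X V' ?W t'" .
  thus "g \<in> germ X x V t"
    unfolding germ_def g using V' o W(2,3) W'(2,3) by blast
qed

lemma germ_eqI:
  assumes "openin (topo X) U" "s \<in> carrier (sec X U)" "openin (topo X) V" "t \<in> carrier (sec X V)"
    and "openin (topo X) W" "x \<in> W" "W \<subseteq> U \<inter> V" "res X U W s = res X V W t"
  shows "germ X x U s = germ X x V t"
  using germ_subset[OF assms] germ_subset[OF assms(3,4,1,2,5,6) _ assms(8)[symmetric]] assms(7)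
  by blast

lemma germ_memD:
  assumes "(V, t) \<in> germ X x U s"
  shows "openin (topo X) V" "x \<in> V" "t \<in> carrier (sec X V)"
    "\<exists>W. openin (topo X) W \<and> x \<in> W \<and> W \<subseteq> U \<inter> V \<and> res X U W s = res X V W t"
  using assms unfolding germ_def by auto

lemma germ_eqD:
  assumes "germ X x U s = germ X x V t" "openin (topo X) V" "x \<in> V" "t \<in> carrier (sec X V)"
  shows "\<exists>W. openin (topo X) W \<and> x \<in> W \<and> W \<subseteq> U \<inter> V \<and> res X U W s = res X V W t"
  using germ_memD(4)[of V t x U s] germ_self[OF assms(2,3,4)] assms(1) by simp

lemma germ_res:
  assumes "openin (topo X) U" "s \<in> carrier (sec X U)" "openin (topo X) V" "V \<subseteq> U" "x \<in> V"
  shows "germ X x V (res X U V s) = germ X x U s"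
  using assms res_id[of V "res X U V s"] res_closed[of U V s]
  by (intro germ_eqI[of _ _ _ _ V]) auto

text \<open>The operations of \<open>stalk\<close> are unions over all representatives. Every member
  of the union is the same class, so the union collapses to it. The general \<open>op\<close>
  compatible with restriction covers addition and multiplication at once.\<close>

lemma union_over_germs:
  fixes op :: "'x set \<Rightarrow> 'a \<Rightarrow> 'a \<Rightarrow> 'a"
  assumes clo: "\<And>W s t. \<lbrakk>openin (topo X) W; s \<in> carrier (sec X W); t \<in> carrier (sec X W)\<rbrakk>
      \<Longrightarrow> op W s t \<in> carrier (sec X W)"
    and op_res: "\<And>W W' s t. \<lbrakk>openin (topo X) W; openin (topo X) W'; W' \<subseteq> W;
      s \<in> carrier (sec X W); t \<in> carrier (sec X W)\<rbrakk>
      \<Longrightarrow> res X W W' (op W s t) = op W' (res X W W' s) (res X W W' t)"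
    and U: "openin (topo X) U" "x \<in> U" "s \<in> carrier (sec X U)" "t \<in> carrier (sec X U)"
  shows "(\<Union>(V, s')\<in>germ X x U s. \<Union>(W, t')\<in>germ X x U t.
      germ X x (V \<inter> W) (op (V \<inter> W) (res X V (V \<inter> W) s') (res X W (V \<inter> W) t'))) = germ X x U (op U s t)"
proof -
  have eq: "germ X x (V \<inter> W) (op (V \<inter> W) (res X V (V \<inter> W) s') (res X W (V \<inter> W) t')) = germ X x U (op U s t)"
    if V: "(V, s') \<in> germ X x U s" and W: "(W, t') \<in> germ X x U t" for V s' W t'
  proof -
    note V' = germ_memD[OF V] and W' = germ_memD[OF W]
    obtain N where N: "openin (topo X) N" "x \<in> N" "N \<subseteq> U \<inter> V" "res X U N s = res X V N s'"
      using V'(4) by blast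
    obtain M where M: "openin (topo X) M" "x \<in> M" "M \<subseteq> U \<inter> W" "res X U M t = res X W M t'"
      using W'(4) by blast
    let ?D = "N \<inter> M" and ?VW = "V \<inter> W"
    have D: "openin (topo X) ?D" "?D \<subseteq> ?VW" "?D \<subseteq> U" and VW: "openin (topo X) ?VW"
      using N M V'(1) W'(1) by auto
    have "res X ?VW ?D (res X V ?VW s') = res X V ?D s'"
      using res_comp[of V ?VW ?D s'] V' VW D by auto
    also have "\<dots> = res X N ?D (res X V N s')" using res_comp[of V N ?D s'] V' N D by auto
    also have "\<dots> = res X U ?D s" using res_comp[of U N ?D s] U N D by auto
    finally have 1: "res X ?VW ?D (res X V ?VW s') = res X U ?D s" .
    have "res X ?VW ?D (res X W ?VW t') = res X W ?D t'"
      using res_comp[of W ?VW ?D t'] W' VW D by auto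
    also have "\<dots> = res X M ?D (res X W M t')" using res_comp[of W M ?D t'] W' M D by auto
    also have "\<dots> = res X U ?D t" using res_comp[of U M ?D t] U M D by auto
    finally have 2: "res X ?VW ?D (res X W ?VW t') = res X U ?D t" .
    have c: "res X V ?VW s' \<in> carrier (sec X ?VW)" "res X W ?VW t' \<in> carrier (sec X ?VW)"
      using res_closed[of V ?VW s'] res_closed[of W ?VW t'] V' W' VW by auto
    show ?thesis
    proof (rule germ_eqI[of _ _ _ _ ?D])
      show "res X ?VW ?D (op ?VW (res X V ?VW s') (res X W ?VW t')) = res X U ?D (op U s t)"
        using op_res[OF VW D(1,2) c] op_res[OF U(1) D(1,3) U(3,4)] 1 2 by simp
    qed (use clo VW c U D N M in auto)
  qed
  show ?thesis
    using germ_self[OF U(1,2,3)] germ_self[OF U(1,2,4)] eq by (fastforce split: prod.splits)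
qed

lemma
  assumes U: "openin (topo X) U" "x \<in> U" "s \<in> carrier (sec X U)" "t \<in> carrier (sec X U)"
  shows germ_mult: "germ X x U s \<otimes>\<^bsub>stalk X x\<^esub> germ X x U t = germ X x U (s \<otimes>\<^bsub>sec X U\<^esub> t)"
    and germ_add: "germ X x U s \<oplus>\<^bsub>stalk X x\<^esub> germ X x U t = germ X x U (s \<oplus>\<^bsub>sec X U\<^esub> t)"
proof -
  have mono: "cring (sec X W)" if "openin (topo X) W" for W using sec_cring that .
  have "\<And>W s t. \<lbrakk>openin (topo X) W; s \<in> carrier (sec X W); t \<in> carrier (sec X W)\<rbrakk>
      \<Longrightarrow> s \<otimes>\<^bsub>sec X W\<^esub> t \<in> carrier (sec X W) \<and> s \<oplus>\<^bsub>sec X W\<^esub> t \<in> carrier (sec X W)"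
    using mono by (meson cring.cring_simprules(1,5))
  moreover have "\<And>W W' s t. \<lbrakk>openin (topo X) W; openin (topo X) W'; W' \<subseteq> W;
      s \<in> carrier (sec X W); t \<in> carrier (sec X W)\<rbrakk>
      \<Longrightarrow> res X W W' (s \<otimes>\<^bsub>sec X W\<^esub> t) = res X W W' s \<otimes>\<^bsub>sec X W'\<^esub> res X W W' t \<and>
        res X W W' (s \<oplus>\<^bsub>sec X W\<^esub> t) = res X W W' s \<oplus>\<^bsub>sec X W'\<^esub> res X W W' t"
    using res_hom by (auto simp: ring_hom_def)
  ultimately show
    "germ X x U s \<otimes>\<^bsub>stalk X x\<^esub> germ X x U t = germ X x U (s \<otimes>\<^bsub>sec X U\<^esub> t)"
    "germ X x U s \<oplus>\<^bsub>stalk X x\<^esub> germ X x U t = germ X x U (s \<oplus>\<^bsub>sec X U\<^esub> t)"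
    using union_over_germs[of "\<lambda>W s t. s \<otimes>\<^bsub>sec X W\<^esub> t", OF _ _ U]
      union_over_germs[of "\<lambda>W s t. s \<oplus>\<^bsub>sec X W\<^esub> t", OF _ _ U]
    by (simp_all add: stalk_def)
qed

lemma germ_closed:
  "\<lbrakk>openin (topo X) U; x \<in> U; s \<in> carrier (sec X U)\<rbrakk> \<Longrightarrow> germ X x U s \<in> carrier (stalk X x)"
  unfolding stalk_def by auto

lemma
  assumes U: "openin (topo X) U" "x \<in> U"
  shows germ_one: "germ X x U \<one>\<^bsub>sec X U\<^esub> = \<one>\<^bsub>stalk X x\<^esub>"
    and germ_zero: "germ X x U \<zero>\<^bsub>sec X U\<^esub> = \<zero>\<^bsub>stalk X x\<^esub>"
proof -
  let ?T = "topspace (topo X)"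
  have T: "openin (topo X) ?T" "U \<subseteq> ?T" using U openin_subset by auto
  interpret T: cring "sec X ?T" using sec_cring[OF T(1)] .
  interpret U: cring "sec X U" using sec_cring[OF U(1)] .
  have h: "res X ?T U \<in> ring_hom (sec X ?T) (sec X U)" using res_hom[OF T(1) U(1) T(2)] .
  have "res X ?T U \<one>\<^bsub>sec X ?T\<^esub> = \<one>\<^bsub>sec X U\<^esub>" using ring_hom_one[OF h] .
  thus "germ X x U \<one>\<^bsub>sec X U\<^esub> = \<one>\<^bsub>stalk X x\<^esub>"
    using germ_res[OF T(1) T.one_closed U(1) T(2) U(2)] by (simp add: stalk_def)
  have "res X ?T U \<zero>\<^bsub>sec X ?T\<^esub> = \<zero>\<^bsub>sec X U\<^esub>"
    using ring_hom_zero[OF h] T.ring_axioms U.ring_axioms by blast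
  thus "germ X x U \<zero>\<^bsub>sec X U\<^esub> = \<zero>\<^bsub>stalk X x\<^esub>"
    using germ_res[OF T(1) T.zero_closed U(1) T(2) U(2)] by (simp add: stalk_def)
qed

end

context locally_ringed_space
begin

lemma stalk_cring: "x \<in> topspace (topo X) \<Longrightarrow> cring (stalk X x)"
  using stalk_local unfolding local_ring_def by blast

lemma open_point: "\<lbrakk>openin (topo X) U; x \<in> U\<rbrakk> \<Longrightarrow> x \<in> topspace (topo X)"
  using openin_subset by blast

lemma germ_pow:
  assumes U: "openin (topo X) U" "x \<in> U" "s \<in> carrier (sec X U)"
  shows "germ X x U (s [^]\<^bsub>sec X U\<^esub> (n::nat)) = germ X x U s [^]\<^bsub>stalk X x\<^esub> n"
proof -
  interpret U: cring "sec X U" using sec_cring[OF U(1)] .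
  show ?thesis
  proof (induction n)
    case 0
    show ?case using germ_one[OF U(1,2)] by simp
  next
    case (Suc n)
    thus ?case using germ_mult[OF U(1,2) U.nat_pow_closed[OF U(3)] U(3), symmetric] by simp
  qed
qed

text \<open>Stated for families of ideals stable under restriction, so that it serves ideal sheaves
  and \<open>sections_in\<close> alike.\<close>

lemma stalk_ideal_ideal:
  assumes I: "\<And>U. openin (topo X) U \<Longrightarrow> ideal (I U) (sec X U)"
    and I_res: "\<And>U V. \<lbrakk>openin (topo X) U; openin (topo X) V; V \<subseteq> U\<rbrakk> \<Longrightarrow> res X U V ` I U \<subseteq> I V"
    and x: "x \<in> topspace (topo X)"
  shows "ideal (stalk_ideal X I x) (stalk X x)"
proof -
  interpret S: cring "stalk X x" using stalk_cring[OF x] .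
  have sub: "I U \<subseteq> carrier (sec X U)" if "openin (topo X) U" for U
    using ring.ideal_subset[OF cring.axioms(1)[OF sec_cring[OF that]] I[OF that]] .
  have mem: "germ X x U s \<in> stalk_ideal X I x" if "openin (topo X) U" "x \<in> U" "s \<in> I U" for U s
    unfolding stalk_ideal_def using that by blast
  show ?thesis
  proof (rule S.cring_idealI)
    show "stalk_ideal X I x \<subseteq> carrier (stalk X x)"
      unfolding stalk_ideal_def using germ_closed sub by blast
    have T: "openin (topo X) (topspace (topo X))" by simp
    show "\<zero>\<^bsub>stalk X x\<^esub> \<in> stalk_ideal X I x"
      using mem[OF T x] germ_zero[OF T x] ring.ideal_zero_mem[OF cring.axioms(1)[OF sec_cring[OF T]] I[OF T]]
      by metis
  next
    fix g h assume "g \<in> stalk_ideal X I x" "h \<in> stalk_ideal X I x"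
    then obtain U s V t where U: "openin (topo X) U" "x \<in> U" "s \<in> I U" "g = germ X x U s"
      and V: "openin (topo X) V" "x \<in> V" "t \<in> I V" "h = germ X x V t"
      unfolding stalk_ideal_def by blast
    let ?W = "U \<inter> V"
    have W: "openin (topo X) ?W" "x \<in> ?W" using U V by auto
    have st: "res X U ?W s \<in> I ?W" "res X V ?W t \<in> I ?W"
      using I_res[OF U(1) W(1)] I_res[OF V(1) W(1)] U V by auto
    have "g = germ X x ?W (res X U ?W s)" "h = germ X x ?W (res X V ?W t)"
      using germ_res[of U s ?W x] germ_res[of V t ?W x] U V W sub by auto
    hence "g \<oplus>\<^bsub>stalk X x\<^esub> h = germ X x ?W (res X U ?W s \<oplus>\<^bsub>sec X ?W\<^esub> res X V ?W t)"
      using germ_add[OF W] st sub[OF W(1)] by auto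
    moreover have "res X U ?W s \<oplus>\<^bsub>sec X ?W\<^esub> res X V ?W t \<in> I ?W"
      using ring.ideal_add_mem[OF cring.axioms(1)[OF sec_cring[OF W(1)]] I[OF W(1)] st] .
    ultimately show "g \<oplus>\<^bsub>stalk X x\<^esub> h \<in> stalk_ideal X I x" using mem[OF W] by simp
  next
    fix g h assume "g \<in> carrier (stalk X x)" "h \<in> stalk_ideal X I x"
    then obtain U s V t where U: "openin (topo X) U" "x \<in> U" "s \<in> carrier (sec X U)" "g = germ X x U s"
      and V: "openin (topo X) V" "x \<in> V" "t \<in> I V" "h = germ X x V t"
      unfolding stalk_ideal_def stalk_def by auto
    let ?W = "U \<inter> V"
    have W: "openin (topo X) ?W" "x \<in> ?W" using U V by auto
    have st: "res X U ?W s \<in> carrier (sec X ?W)" "res X V ?W t \<in> I ?W"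
      using res_closed[OF U(1) W(1)] I_res[OF V(1) W(1)] U V by auto
    have "g = germ X x ?W (res X U ?W s)" "h = germ X x ?W (res X V ?W t)"
      using germ_res[of U s ?W x] germ_res[of V t ?W x] U V W sub by auto
    hence "g \<otimes>\<^bsub>stalk X x\<^esub> h = germ X x ?W (res X U ?W s \<otimes>\<^bsub>sec X ?W\<^esub> res X V ?W t)"
      using germ_mult[OF W] st sub[OF W(1)] by auto
    moreover have "res X U ?W s \<otimes>\<^bsub>sec X ?W\<^esub> res X V ?W t \<in> I ?W"
      using ideal.I_l_closed[OF I[OF W(1)] st(2,1)] .
    ultimately show "g \<otimes>\<^bsub>stalk X x\<^esub> h \<in> stalk_ideal X I x" using mem[OF W] by simp
  qed
qed

lemma stalk_ideal_sheaf_ideal: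
  assumes "ideal_sheaf X I" "x \<in> topspace (topo X)"
  shows "ideal (stalk_ideal X I x) (stalk X x)"
proof (rule stalk_ideal_ideal[OF _ _ assms(2)])
  show "ideal (I U) (sec X U)" if "openin (topo X) U" for U
    using assms(1) that by (simp add: ideal_sheaf_def)
  show "res X U V ` I U \<subseteq> I V" if "openin (topo X) U" "openin (topo X) V" "V \<subseteq> U" for U V
    using assms(1) that by (simp add: ideal_sheaf_def)
qed

text \<open>The stalk of this sheaf at \<open>x\<close> may be smaller than \<open>A x\<close>.\<close>

definition sections_in :: "('x \<Rightarrow> ('x set \<times> 'a) set set) \<Rightarrow> ('x, 'a) ideal_data" where
  "sections_in A U = {s \<in> carrier (sec X U). \<forall>x\<in>U. germ X x U s \<in> A x}"

lemma stalk_ideal_sections_in_subset: "stalk_ideal X (sections_in A) x \<subseteq> A x"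
  unfolding stalk_ideal_def sections_in_def by blast

lemma stalk_ideal_sections_in_ideal:
  assumes A: "\<And>x. x \<in> topspace (topo X) \<Longrightarrow> ideal (A x) (stalk X x)"
    and x: "x \<in> topspace (topo X)"
  shows "ideal (stalk_ideal X (sections_in A) x) (stalk X x)"
proof (rule stalk_ideal_ideal[OF _ _ x])
  fix U assume U: "openin (topo X) U"
  interpret U: cring "sec X U" using sec_cring[OF U] .
  have A': "ideal (A x) (stalk X x)" "ring (stalk X x)" if "x \<in> U" for x
    using A open_point[OF U that] stalk_cring[OF open_point[OF U that]] cring.axioms(1) by blast+
  show "ideal (sections_in A U) (sec X U)"
  proof (rule U.cring_idealI)
    show "sections_in A U \<subseteq> carrier (sec X U)" unfolding sections_in_def by blast
    show "\<zero>\<^bsub>sec X U\<^esub> \<in> sections_in A U"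
      unfolding sections_in_def using germ_zero[OF U] ring.ideal_zero_mem[OF A'(2,1)] by auto
    show "s \<oplus>\<^bsub>sec X U\<^esub> t \<in> sections_in A U" if "s \<in> sections_in A U" "t \<in> sections_in A U" for s t
      using that germ_add[OF U, symmetric] ring.ideal_add_mem[OF A'(2,1)]
      unfolding sections_in_def by auto
    show "s \<otimes>\<^bsub>sec X U\<^esub> t \<in> sections_in A U" if "s \<in> carrier (sec X U)" "t \<in> sections_in A U" for s t
      using that germ_mult[OF U, symmetric] ideal.I_l_closed[OF A'(1)] germ_closed[OF U]
      unfolding sections_in_def by auto
  qed
next
  fix U V assume *: "openin (topo X) U" "openin (topo X) V" "V \<subseteq> U"
  show "res X U V ` sections_in A U \<subseteq> sections_in A V"
    using * res_closed[OF *] germ_res[OF *(1) _ *(2,3)] unfolding sections_in_def by auto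
qed

lemma not_in_zero_locus_iff:
  assumes I: "ideal_sheaf X I" and x: "x \<in> topspace (topo X)"
  shows "x \<notin> zero_locus X I \<longleftrightarrow> \<one>\<^bsub>stalk X x\<^esub> \<in> stalk_ideal X I x"
proof -
  interpret S: cring "stalk X x" using stalk_cring[OF x] .
  have "ideal (stalk_ideal X I x) (stalk X x)"
    using stalk_ideal_sheaf_ideal[OF I x] .
  thus ?thesis
    unfolding zero_locus_def using x ideal.one_imp_carrier[of _ "stalk X x"] S.one_closed by auto
qed

text \<open>The unit ideal at \<open>x\<close> is witnessed by one section whose germ is one. It
  equals one on a neighbourhood, so it witnesses the unit ideal at every point there.\<close>

lemma openin_zero_locus_compl:
  assumes I: "ideal_sheaf X I"
  shows "openin (topo X) (topspace (topo X) - zero_locus X I)"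
proof (subst openin_subopen, rule ballI)
  fix x assume "x \<in> topspace (topo X) - zero_locus X I"
  hence "\<one>\<^bsub>stalk X x\<^esub> \<in> stalk_ideal X I x" using not_in_zero_locus_iff[OF I] by auto
  then obtain U s where U: "openin (topo X) U" "x \<in> U" "s \<in> I U" "\<one>\<^bsub>stalk X x\<^esub> = germ X x U s"
    unfolding stalk_ideal_def by blast
  have id: "ideal (I U) (sec X U)" using I U(1) by (simp add: ideal_sheaf_def)
  have sU: "s \<in> carrier (sec X U)" using ideal.Icarr[OF id U(3)] .
  have one: "\<one>\<^bsub>sec X U\<^esub> \<in> carrier (sec X U)" using cring.axioms(1)[OF sec_cring[OF U(1)]] 
    by (simp add: ring.ring_simprules(6))
  have "germ X x U s = germ X x U \<one>\<^bsub>sec X U\<^esub>" using germ_one[OF U(1,2)] U(4) by simp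
  then obtain W where W: "openin (topo X) W" "x \<in> W" "W \<subseteq> U"
    "res X U W s = res X U W \<one>\<^bsub>sec X U\<^esub>"
    using germ_eqD[OF _ U(1,2) one, of U s] by auto
  have "y \<in> topspace (topo X) - zero_locus X I" if y: "y \<in> W" for y
  proof -
    have yU: "y \<in> U" using y W(3) by blast
    have "germ X y U s = germ X y U \<one>\<^bsub>sec X U\<^esub>"
      using germ_eqI[OF U(1) sU U(1) one W(1) y] W(3,4) by simp
    hence "\<one>\<^bsub>stalk X y\<^esub> \<in> stalk_ideal X I y"
      using germ_one[OF U(1) yU] U(1,3) yU unfolding stalk_ideal_def by force
    thus ?thesis using not_in_zero_locus_iff[OF I] open_point[OF W(1) y] by blast
  qed
  thus "\<exists>T. openin (topo X) T \<and> x \<in> T \<and> T \<subseteq> topspace (topo X) - zero_locus X I"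
    using W(1,2) by blast
qed

end

section \<open>Monomial ideals of a simple normal crossings divisor\<close>

text \<open>This is \<open>d\<^sub>k(x)\<close>: a component that misses \<open>x\<close> has the
  unit ideal there and contributes no degree.\<close>

definition monomial_order ::
  "('x, 'a) space_data \<Rightarrow> ('j \<Rightarrow> ('x, 'a) ideal_data) \<Rightarrow> 'j set \<Rightarrow> ('j \<Rightarrow> nat) \<Rightarrow> 'x \<Rightarrow> nat" where
  "monomial_order X E S a x = (\<Sum>i\<in>S. if x \<in> zero_locus X (E i) then a i else 0)"

text \<open>The ideal that \<open>monomial_ideal\<close> prescribes at \<open>x\<close>. The actual
  stalk of that sheaf is compared with it by an inclusion and, from below, by an explicit
  section.\<close>

definition monomial_stalk ::
  "('x, 'a) space_data \<Rightarrow> ('j \<Rightarrow> ('x, 'a) ideal_data) \<Rightarrow> 'j set \<Rightarrow> ('j \<Rightarrow> nat) \<Rightarrow> 'x \<Rightarrow>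
    ('x set \<times> 'a) set set" where
  "monomial_stalk X E S a x =
    (\<Otimes>\<^bsub>ideals_set (stalk X x)\<^esub>i\<in>S. stalk_ideal X (E i) x [^]\<^bsub>ideals_set (stalk X x)\<^esub> a i)"

locale snc_space = locally_ringed_space X for X :: "('x, 'a) space_data" +
  fixes J :: "'j set" and E :: "'j \<Rightarrow> ('x, 'a) ideal_data"
  assumes snc: "snc_divisor X J E"
begin

lemma ideal_sheaf_E: "i \<in> J \<Longrightarrow> ideal_sheaf X (E i)"
  using snc by (simp add: snc_divisor_def coherent_ideal_def)

lemma stalk_E_ideal:
  assumes "i \<in> J" "x \<in> topspace (topo X)"
  shows "ideal (stalk_ideal X (E i) x) (stalk X x)"
  using ideal_sheaf_E[OF assms(1)] assms(2) by (rule stalk_ideal_sheaf_ideal)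

lemma obtain_parameters:
  assumes "x \<in> topspace (topo X)"
  obtains xs where "regular_parameters (stalk X x) xs"
    "\<And>i. \<lbrakk>i \<in> J; x \<in> zero_locus X (E i)\<rbrakk> \<Longrightarrow> \<exists>U e. openin (topo X) U \<and> x \<in> U \<and>
      e \<in> carrier (sec X U) \<and> germ X x U e \<in> set xs \<and> defined_by_on X (E i) U e"
proof -
  obtain xs c where "regular_parameters (stalk X x) xs"
    and *: "\<forall>j\<in>J. x \<in> zero_locus X (E j) \<longrightarrow> c j < length xs \<and>
           (\<exists>U e. openin (topo X) U \<and> x \<in> U \<and> e \<in> carrier (sec X U) \<and>
              germ X x U e = xs ! c j \<and> defined_by_on X (E j) U e)"
    using snc[unfolded snc_divisor_def, THEN conjunct2, THEN conjunct2, THEN conjunct2,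
        THEN bspec, OF assms]
    by (elim exE conjE) blast
  moreover have "\<exists>U e. openin (topo X) U \<and> x \<in> U \<and>
      e \<in> carrier (sec X U) \<and> germ X x U e \<in> set xs \<and> defined_by_on X (E i) U e"
    if "i \<in> J" "x \<in> zero_locus X (E i)" for i
    using * that nth_mem[of "c i" xs] by metis
  ultimately show ?thesis using that by blast
qed

lemma max_ideal_ideal:
  assumes "x \<in> topspace (topo X)"
  shows "ideal (max_ideal (stalk X x)) (stalk X x)"
  using stalk_local[OF assms] theI'[of "\<lambda>M. maximalideal M (stalk X x)"] maximalideal.axioms(1)
  unfolding local_ring_def max_ideal_def by blast

lemma monomial_stalk_ideal:
  assumes "S \<subseteq> J" "x \<in> topspace (topo X)"
  shows "ideal (monomial_stalk X E S a x) (stalk X x)"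
proof -
  interpret S: cring "stalk X x" using stalk_cring[OF assms(2)] .
  show ?thesis
    unfolding monomial_stalk_def
  proof (rule S.ideal_finprod_ideal)
    fix i assume "i \<in> S"
    hence "i \<in> J" using assms(1) by blast
    thus "ideal (stalk_ideal X (E i) x [^]\<^bsub>ideals_set (stalk X x)\<^esub> a i) (stalk X x)"
      using S.ideal_pow_ideal stalk_E_ideal[OF _ assms(2)] by simp
  qed
qed

text \<open>A component through \<open>x\<close> has its ideal inside the maximal ideal. For any
  other one the bound is the zeroth power, the whole ring.\<close>

lemma monomial_stalk_subset_pow:
  assumes S: "finite S" "S \<subseteq> J" and x: "x \<in> topspace (topo X)"
  shows "monomial_stalk X E S a x \<subseteq>
    max_ideal (stalk X x) [^]\<^bsub>ideals_set (stalk X x)\<^esub> monomial_order X E S a x"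
proof -
  obtain xs where "regular_parameters (stalk X x) xs" using obtain_parameters[OF x] by blast
  hence "noetherian_ring (stalk X x)" unfolding regular_parameters_def by blast
  then interpret S: noetherian_cring "stalk X x"
    using stalk_cring[OF x] by (simp add: noetherian_cring_def)
  show ?thesis
    unfolding monomial_stalk_def monomial_order_def
  proof (rule S.ideal_finprod_subset_pow[OF S(1) max_ideal_ideal[OF x]])
    fix i assume "i \<in> S"
    hence E: "ideal (stalk_ideal X (E i) x) (stalk X x)" using stalk_E_ideal S(2) x by blast
    show P: "ideal (stalk_ideal X (E i) x [^]\<^bsub>ideals_set (stalk X x)\<^esub> a i) (stalk X x)"
      using S.ideal_pow_ideal[OF E] .
    show "stalk_ideal X (E i) x [^]\<^bsub>ideals_set (stalk X x)\<^esub> a i \<subseteq>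
      max_ideal (stalk X x) [^]\<^bsub>ideals_set (stalk X x)\<^esub> (if x \<in> zero_locus X (E i) then a i else 0)"
    proof (cases "x \<in> zero_locus X (E i)")
      case True
      hence "stalk_ideal X (E i) x \<subseteq> max_ideal (stalk X x)"
        using S.proper_ideal_subset_max_ideal[OF stalk_local[OF x] E] unfolding zero_locus_def by blast
      thus ?thesis using True S.ideal_pow_mono by simp
    next
      case False
      thus ?thesis using S.ideal_subset[OF P] by (simp add: S.ideal_pow_0 del: S.nat_pow_0)
    qed
  qed
qed

text \<open>The germ at \<open>x\<close> must be a monomial, and the germs at all nearby points must
  lie in the prescribed ideals too, since sections of the monomial sheaf are defined pointwise. The
  section is a product of local equations over the components, on a shrinking neighbourhood.\<close>

lemma exists_monomial_section:
  assumes S: "finite S" "S \<subseteq> J" and x: "x \<in> topspace (topo X)"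
    and par: "\<And>i. \<lbrakk>i \<in> J; x \<in> zero_locus X (E i)\<rbrakk> \<Longrightarrow> \<exists>U e. openin (topo X) U \<and> x \<in> U \<and>
      e \<in> carrier (sec X U) \<and> germ X x U e \<in> M \<and> defined_by_on X (E i) U e"
    and M: "M \<subseteq> carrier (stalk X x)"
  shows "\<exists>W s. openin (topo X) W \<and> x \<in> W \<and> s \<in> sections_in (monomial_stalk X E S a) W \<and>
    germ X x W s \<in> monomials (stalk X x) M (monomial_order X E S a x)"
  using S
proof (induction S rule: finite_induct)
  case empty
  let ?T = "topspace (topo X)"
  have T: "openin (topo X) ?T" by simp
  interpret T: cring "sec X ?T" using sec_cring[OF T] .
  have "germ X y ?T \<one>\<^bsub>sec X ?T\<^esub> \<in> monomial_stalk X E {} a y" if "y \<in> ?T" for y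
    using germ_one[OF T that] cring.cring_simprules(6)[OF stalk_cring[OF that]]
    by (simp add: monomial_stalk_def cring.ideal_finprod_empty[OF stalk_cring[OF that]])
  thus ?case
    using germ_one[OF T x] x
    by (intro exI[of _ ?T] exI[of _ "\<one>\<^bsub>sec X ?T\<^esub>"]) (auto simp: sections_in_def monomial_order_def)
next
  case (insert i S)
  obtain W s where W: "openin (topo X) W" "x \<in> W" and s: "s \<in> sections_in (monomial_stalk X E S a) W"
    and sx: "germ X x W s \<in> monomials (stalk X x) M (monomial_order X E S a x)"
    using insert by blast
  have i: "i \<in> J" "S \<subseteq> J" using insert.prems by auto
  obtain U e where U: "openin (topo X) U" "x \<in> U" and e: "e \<in> carrier (sec X U)"
    and eE: "\<And>y. y \<in> U \<Longrightarrow> germ X y U e \<in> stalk_ideal X (E i) y"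
    and ex: "germ X x U e [^]\<^bsub>stalk X x\<^esub> a i \<in>
      monomials (stalk X x) M (if x \<in> zero_locus X (E i) then a i else 0)"
  proof (cases "x \<in> zero_locus X (E i)")
    case True
    then obtain U e where U: "openin (topo X) U" "x \<in> U" "e \<in> carrier (sec X U)" "germ X x U e \<in> M"
      "defined_by_on X (E i) U e"
      using par i by blast
    have "germ X y U e \<in> stalk_ideal X (E i) y" if "y \<in> U" for y
      using ring.cgenideal_self[OF cring.axioms(1)[OF stalk_cring[OF open_point[OF U(1) that]]]
          germ_closed[OF U(1) that U(3)]] U(5) that
      by (simp add: defined_by_on_def)
    thus ?thesis
      using that U True cring.monomials_pow[OF stalk_cring[OF x] M U(4)] by auto
  next
    \<comment> \<open>Off \<open>E i\<close> the constant one lies in the ideal at every point. Its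
      power at \<open>x\<close> is the monomial of degree zero, matching the exponent counted by
      \<open>monomial_order\<close>.\<close>
    case False
    let ?U = "topspace (topo X) - zero_locus X (E i)"
    have U: "openin (topo X) ?U" using openin_zero_locus_compl[OF ideal_sheaf_E[OF i(1)]] .
    interpret U: cring "sec X ?U" using sec_cring[OF U] .
    interpret S: cring "stalk X x" using stalk_cring[OF x] .
    have "x \<in> ?U" using x False by blast
    moreover have "germ X y ?U \<one>\<^bsub>sec X ?U\<^esub> \<in> stalk_ideal X (E i) y" if "y \<in> ?U" for y
      using germ_one[OF U that] not_in_zero_locus_iff[OF ideal_sheaf_E[OF i(1)]] that by auto
    ultimately show ?thesis using that[OF U _ U.one_closed] False germ_one[OF U] by auto
  qed
  let ?V = "W \<inter> U"
  have V: "openin (topo X) ?V" "x \<in> ?V" using W U by auto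
  interpret V: cring "sec X ?V" using sec_cring[OF V(1)] .
  define s' where "s' = res X W ?V s"
  define e' where "e' = res X U ?V e [^]\<^bsub>sec X ?V\<^esub> a i"
  have sW: "s \<in> carrier (sec X W)" using s unfolding sections_in_def by blast
  have s': "s' \<in> carrier (sec X ?V)" "\<And>y. y \<in> ?V \<Longrightarrow> germ X y ?V s' = germ X y W s"
    unfolding s'_def using res_closed[of W ?V s] germ_res[of W s ?V] W V sW by auto
  have r: "res X U ?V e \<in> carrier (sec X ?V)" using res_closed[of U ?V e] U V e by auto
  have e': "e' \<in> carrier (sec X ?V)"
    "\<And>y. y \<in> ?V \<Longrightarrow> germ X y ?V e' = germ X y U e [^]\<^bsub>stalk X y\<^esub> a i"
    unfolding e'_def using r germ_pow[OF V(1) _ r] germ_res[of U e ?V] U V e by auto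
  have es: "e' \<otimes>\<^bsub>sec X ?V\<^esub> s' \<in> carrier (sec X ?V)" using e' s' by simp
  have germ_es: "germ X y ?V (e' \<otimes>\<^bsub>sec X ?V\<^esub> s') =
      (germ X y U e [^]\<^bsub>stalk X y\<^esub> a i) \<otimes>\<^bsub>stalk X y\<^esub> germ X y W s" if "y \<in> ?V" for y
    using germ_mult[OF V(1) that e'(1) s'(1)] e'(2)[OF that] s'(2)[OF that] by simp
  have "germ X y ?V (e' \<otimes>\<^bsub>sec X ?V\<^esub> s') \<in> monomial_stalk X E (insert i S) a y" if y: "y \<in> ?V" for y
  proof -
    have yT: "y \<in> topspace (topo X)" using open_point[OF V(1) y] .
    interpret S: cring "stalk X y" using stalk_cring[OF yT] .
    have "monomial_stalk X E (insert i S) a y =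
      (stalk_ideal X (E i) y [^]\<^bsub>ideals_set (stalk X y)\<^esub> a i) \<cdot>\<^bsub>stalk X y\<^esub> monomial_stalk X E S a y"
      unfolding monomial_stalk_def
    proof (rule S.ideal_finprod_insert[OF insert.hyps(1,2)])
      fix j assume "j \<in> insert i S"
      hence "j \<in> J" using insert.prems by blast
      thus "ideal (stalk_ideal X (E j) y [^]\<^bsub>ideals_set (stalk X y)\<^esub> a j) (stalk X y)"
        using S.ideal_pow_ideal stalk_E_ideal[OF _ yT] by simp
    qed
    moreover have "germ X y U e \<in> stalk_ideal X (E i) y" "germ X y W s \<in> monomial_stalk X E S a y"
      using y eE s unfolding sections_in_def by auto
    ultimately show ?thesis
      unfolding germ_es[OF y] using S.ideal_pow_mem ideal_prod.prod by metis
  qed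
  moreover have "germ X x ?V (e' \<otimes>\<^bsub>sec X ?V\<^esub> s') \<in>
      monomials (stalk X x) M (monomial_order X E (insert i S) a x)"
    unfolding germ_es[OF V(2)]
    using cring.monomials_mult[OF stalk_cring[OF x] M ex sx] insert.hyps
    by (simp add: monomial_order_def)
  ultimately show ?case
    using V es unfolding sections_in_def by blast
qed

section \<open>The order of an ideal locally generated by monomials\<close>

context
  fixes r :: nat and S :: "nat \<Rightarrow> 'j set" and a :: "nat \<Rightarrow> 'j \<Rightarrow> nat" and I :: "('x, 'a) ideal_data"
  assumes S: "\<And>k. k < r \<Longrightarrow> finite (S k)" "\<And>k. k < r \<Longrightarrow> S k \<subseteq> J"
    and I: "\<And>U. openin (topo X) U \<Longrightarrow> I U = sum_ideal X r (\<lambda>k. monomial_ideal X E (S k) (a k)) U"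
begin

lemma monomial_ideal_eq: "monomial_ideal X E (S k) (a k) = sections_in (monomial_stalk X E (S k) (a k))"
  unfolding monomial_ideal_def sections_in_def monomial_stalk_def by simp

lemma stalk_monomial_ideal:
  assumes "k < r" "x \<in> topspace (topo X)"
  shows "ideal (stalk_ideal X (monomial_ideal X E (S k) (a k)) x) (stalk X x)"
  unfolding monomial_ideal_eq
  using stalk_ideal_sections_in_ideal monomial_stalk_ideal[OF S(2)[OF assms(1)]] assms(2) by blast

text \<open>An arbitrary common lower bound \<open>n\<close> stands in for the minimum. This
  includes \<open>r = 0\<close>, where the ideal is zero and every \<open>n\<close> is a
  bound.\<close>

lemma order_at_ge:
  assumes x: "x \<in> topspace (topo X)" and n: "\<And>k. k < r \<Longrightarrow> n \<le> monomial_order X E (S k) (a k) x"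
  shows "enat n \<le> order_at X I x"
proof -
  interpret S: cring "stalk X x" using stalk_cring[OF x] .
  let ?m = "max_ideal (stalk X x)" and ?F = "\<lambda>k. stalk_ideal X (monomial_ideal X E (S k) (a k)) x"
  have "stalk_ideal X I x \<subseteq> (\<Oplus>\<^bsub>ideals_set (stalk X x)\<^esub>k\<in>{..<r}. ?F k)"
    unfolding stalk_ideal_def[of X I] using I unfolding sum_ideal_def by blast
  also have "\<dots> \<subseteq> ?m [^]\<^bsub>ideals_set (stalk X x)\<^esub> n"
  proof (rule S.ideal_finsum_minimal)
    show "ideal (?m [^]\<^bsub>ideals_set (stalk X x)\<^esub> n) (stalk X x)"
      using S.ideal_pow_ideal max_ideal_ideal[OF x] by blast
    fix k assume "k \<in> {..<r}"
    hence k: "k < r" by simp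
    show "ideal (?F k) (stalk X x)" using stalk_monomial_ideal[OF k x] .
    have "?F k \<subseteq> monomial_stalk X E (S k) (a k) x"
      unfolding monomial_ideal_eq using stalk_ideal_sections_in_subset .
    also have "\<dots> \<subseteq> ?m [^]\<^bsub>ideals_set (stalk X x)\<^esub> monomial_order X E (S k) (a k) x"
      using monomial_stalk_subset_pow[OF S[OF k] x] .
    also have "\<dots> \<subseteq> ?m [^]\<^bsub>ideals_set (stalk X x)\<^esub> n"
      using S.ideal_pow_antimono[OF max_ideal_ideal[OF x] n[OF k]] .
    finally show "?F k \<subseteq> ?m [^]\<^bsub>ideals_set (stalk X x)\<^esub> n" .
  qed simp
  finally show ?thesis unfolding order_at_def by (intro Sup_upper) blast
qed

text \<open>The section built near \<open>x\<close> lies in the \<open>k\<close>-th summand at every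
  point of its domain, hence in \<open>I\<close>. Its germ is a monomial of degree \<open>?d\<close>
  in the parameters, so it is in no higher power of the maximal ideal.\<close>

lemma order_at_le:
  assumes x: "x \<in> topspace (topo X)" and k: "k < r"
  shows "order_at X I x \<le> enat (monomial_order X E (S k) (a k) x)"
  unfolding order_at_def
proof (rule Sup_least)
  let ?d = "monomial_order X E (S k) (a k) x"
  fix q assume "q \<in> {enat n |n. stalk_ideal X I x \<subseteq>
    max_ideal (stalk X x) [^]\<^bsub>ideals_set (stalk X x)\<^esub> n}"
  then obtain n where n: "q = enat n"
    "stalk_ideal X I x \<subseteq> max_ideal (stalk X x) [^]\<^bsub>ideals_set (stalk X x)\<^esub> n" by blast
  obtain xs where xs: "regular_parameters (stalk X x) xs"
    "\<And>i. \<lbrakk>i \<in> J; x \<in> zero_locus X (E i)\<rbrakk> \<Longrightarrow> \<exists>U e. openin (topo X) U \<and> x \<in> U \<and>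
      e \<in> carrier (sec X U) \<and> germ X x U e \<in> set xs \<and> defined_by_on X (E i) U e"
    using obtain_parameters[OF x] by blast
  have M: "set xs \<subseteq> carrier (stalk X x)" using xs(1) unfolding regular_parameters_def by blast
  obtain W s where W: "openin (topo X) W" "x \<in> W"
    and s: "s \<in> sections_in (monomial_stalk X E (S k) (a k)) W"
    and sx: "germ X x W s \<in> monomials (stalk X x) (set xs) ?d"
    using exists_monomial_section[OF S[OF k] x xs(2) M] by blast
  have "germ X y W s \<in> (\<Oplus>\<^bsub>ideals_set (stalk X y)\<^esub>k\<in>{..<r}. stalk_ideal X (monomial_ideal X E (S k) (a k)) y)"
    if y: "y \<in> W" for y
  proof -
    have yT: "y \<in> topspace (topo X)" using open_point[OF W(1) y] .
    have "germ X y W s \<in> stalk_ideal X (monomial_ideal X E (S k) (a k)) y"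
      unfolding monomial_ideal_eq stalk_ideal_def using W(1) y s by blast
    moreover have "stalk_ideal X (monomial_ideal X E (S k) (a k)) y \<subseteq>
      (\<Oplus>\<^bsub>ideals_set (stalk X y)\<^esub>k\<in>{..<r}. stalk_ideal X (monomial_ideal X E (S k) (a k)) y)"
      using stalk_monomial_ideal[OF _ yT] k
      by (intro cring.ideal_finsum_superset[OF stalk_cring[OF yT]]) auto
    ultimately show ?thesis by blast
  qed
  hence "s \<in> I W" using I[OF W(1)] s unfolding sum_ideal_def sections_in_def by blast
  hence "germ X x W s \<in> stalk_ideal X I x" unfolding stalk_ideal_def using W by blast
  hence "\<not> ?d < n" using monomial_notin_ideal_pow[OF xs(1) sx] n(2) by blast
  thus "q \<le> enat ?d" unfolding n(1) by simp
qed

lemma openin_order_at_less: "openin (topo X) {x \<in> topspace (topo X). order_at X I x < b}"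
proof (subst openin_subopen, rule ballI)
  fix x assume "x \<in> {x \<in> topspace (topo X). order_at X I x < b}"
  hence x: "x \<in> topspace (topo X)" "order_at X I x < b" by auto
  obtain k where k: "k < r" "enat (monomial_order X E (S k) (a k) x) < b"
  proof (rule ccontr)
    assume "\<not> thesis"
    hence ge: "b \<le> enat (monomial_order X E (S k) (a k) x)" if "k < r" for k
      using that \<open>\<And>k. \<lbrakk>k < r; _\<rbrakk> \<Longrightarrow> thesis\<close> not_less by blast
    \<comment> \<open>A natural number is needed to apply \<open>order_at_ge\<close>. For
      \<open>b = \<infinity>\<close> it is one more than the order, which is then finite.\<close>
    obtain n where n: "order_at X I x < enat n" "enat n \<le> b"
    proof (cases b)
      case (enat n)
      thus ?thesis using that x(2) by simp
    next
      case infinity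
      then obtain q where "order_at X I x = enat q" using x(2) by auto
      thus ?thesis using that[of "Suc q"] infinity by simp
    qed
    have "n \<le> monomial_order X E (S k) (a k) x" if "k < r" for k
      using order_trans[OF n(2) ge[OF that]] by simp
    thus False using order_at_ge[OF x(1)] n(1) not_less by blast
  qed
  \<comment> \<open>Removing the finitely many components of the \<open>k\<close>-th monomial that
    miss \<open>x\<close> ensures that no new component appears nearby, so the degree can only
    drop.\<close>
  let ?N = "{i \<in> S k. x \<notin> zero_locus X (E i)}"
  \<comment> \<open>The final intersection with the whole space matters when \<open>?N\<close> is
    empty, where the indexed intersection is the whole type.\<close>
  let ?W = "(\<Inter>i\<in>?N. topspace (topo X) - zero_locus X (E i)) \<inter> topspace (topo X)"
  have "openin (topo X) ?W"
    using S[OF k(1)] openin_zero_locus_compl ideal_sheaf_E by (intro openin_INT) auto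
  moreover have "x \<in> ?W" using x(1) by blast
  moreover have "y \<in> {x \<in> topspace (topo X). order_at X I x < b}" if y: "y \<in> ?W" for y
  proof -
    have yT: "y \<in> topspace (topo X)" using y by blast
    have "x \<in> zero_locus X (E i)" if "i \<in> S k" "y \<in> zero_locus X (E i)" for i
      using y that by blast
    hence "monomial_order X E (S k) (a k) y \<le> monomial_order X E (S k) (a k) x"
      unfolding monomial_order_def by (intro sum_mono) auto
    hence "order_at X I y < b"
      using order_at_le[OF yT k(1)] k(2) by (meson enat_ord_simps(1) le_less_trans order_trans)
    thus ?thesis using yT by blast
  qed
  ultimately show "\<exists>T. openin (topo X) T \<and> x \<in> T \<and> T \<subseteq> {x \<in> topspace (topo X). order_at X I x < b}"
    by blast
qed

end

end

theorem corollary3p4p5: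
  fixes X :: "('x, 'a) space_data"
    and \<Psi> :: "nat \<Rightarrow> ('x, 'a, 'x, 'a) morph_data"
    and C :: "'i set" and U :: "'i \<Rightarrow> 'x set" and \<psi> :: "'i \<Rightarrow> nat \<Rightarrow> 'a \<Rightarrow> 'a"
    and J :: "'j set" and E :: "'j \<Rightarrow> ('x, 'a) ideal_data"
    and I :: "('x, 'a) ideal_data"
  assumes "noetherian_scheme X"
    and "Z_smooth_scheme X"
    and "lambda_scheme X \<Psi>"
    and "affine_lambda_cover X \<Psi> C U \<psi>"
    and "snc_divisor X J E"
    and "Z_flat_divisor X J E"
    and "locally_toric X C U \<psi> J E"
    and "coherent_ideal X I"
    and "locally_generated_by_monomials X J E I"
  shows "upper_semicontinuous_on (topo X) (\<lambda>x. order_at X I x) \<and>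
    (\<forall>m. closedin (topo X) (order_supp X I m))"
proof -
  have "scheme X" using assms(1) unfolding noetherian_scheme_def by blast
  then interpret snc_space X J E
    using assms(5) by (simp add: snc_space_def snc_space_axioms_def scheme.axioms(1))
  obtain r S a where S: "\<forall>k<r. finite (S k) \<and> S k \<subseteq> J"
    and I: "\<forall>U. openin (topo X) U \<longrightarrow> I U = sum_ideal X r (\<lambda>k. monomial_ideal X E (S k) (a k)) U"
    using assms(9) unfolding locally_generated_by_monomials_def by blast
  have less: "openin (topo X) {x \<in> topspace (topo X). order_at X I x < b}" for b
    using openin_order_at_less[of r S I a b] S I by blast
  have "closedin (topo X) (order_supp X I m)" for m
  proof -
    have "order_supp X I m = topspace (topo X) - {x \<in> topspace (topo X). order_at X I x < enat m}"
      unfolding order_supp_def by (auto simp: not_less)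
    thus ?thesis using less[of "enat m"] by auto
  qed
  thus ?thesis using less unfolding upper_semicontinuous_on_def by blast
qed

end
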